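(* Let $G$ be a reductive algebraic group over an algebraically closed field $\mathbb{K}$ of characteristic $p>0$. For all $r,s\in\mathbb{N}$ with $s\le r$, the map $\Upsilon_{r,s}:U^{[r]}(G)\to U^{[r-s]}(G)^{[s]}$ is $G$-equivariant.
   Context: $\mathbb{N}=\{0,1,2,\dots\}$. With $I_1=\{f\in\mathbb{K}[G]: f(1)=0\}$, $\mathrm{Dist}_k(G)$ is the space of linear maps $\mu:\mathbb{K}[G]\to\mathbb{K}$ with $\mu(I_1^{k+1})=0$, $\mathrm{Dist}_k^{+}(G)=\{\mu\in\mathrm{Dist}_k(G):\mu(1)=0\}$, and $\mathrm{Dist}(G)=\bigcup_k\mathrm{Dist}_k(G)$ is the distribution algebra with product $\mu\rho=(\mu\otimes\rho)\circ\Delta$. $U^{[r]}(G)=T(\mathrm{Dist}^+_{p^{r+1}-1}(G))/Q$, where $T$ is the tensor algebra and $Q$ is the two-sided ideal generated by the relations (i) $x\otimes y=xy$ for $x\in\mathrm{Dist}^+_i(G)$, $y\in\mathrm{Dist}^+_j(G)$ with $i+j<p^{r+1}$; (ii) $x\otimes y-y\otimes x=[x,y]$ for $x\in\mathrm{Dist}^+_i(G)$, $y\in\mathrm{Dist}^+_j(G)$ with $i+j\le p^{r+1}$ (right-hand sides computed in $\mathrm{Dist}(G)$). The adjoint action of $G$ on $\mathrm{Dist}(G)$ (induced by conjugation of $G$ on itself) preserves each $\mathrm{Dist}^+_k(G)$ and hence induces an action of $G$ on $U^{[r]}(G)$ by algebra automorphisms. Geometric Frobenius: a reductive group is defined over $\mathbb{F}_p$;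 fix such a form, so $\mathbb{K}[G]=\mathbb{F}_p[G]\otimes_{\mathbb{F}_p}\mathbb{K}$. $F_g^s:G\to G$ is the endomorphism corresponding to $f\otimes a\mapsto f^{p^s}\otimes a$ on $\mathbb{K}[G]$. $\Xi_s:\mathrm{Dist}(G)\to\mathrm{Dist}(G)$, $\Xi_s(\delta)(f\otimes a)=\delta(f^{p^s}\otimes a)$, is the induced Hopf algebra homomorphism; it maps $\mathrm{Dist}^+_{p^{r+1}-1}(G)$ into $\mathrm{Dist}^+_{p^{r-s+1}-1}(G)$ and induces the Hopf algebra homomorphism $\Upsilon_{r,s}:U^{[r]}(G)\to U^{[r-s]}(G)$ sending the class of $\delta$ to the class of $\Xi_s(\delta)$. For a $G$-module $M$, $M^{[s]}$ denotes the same space with the $G$-action twisted by $F_g^s$ (i.e. $g$ acts on $M^{[s]}$ as $F_g^s(g)$ acts on $M$). *)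

theory Defs
  imports
    "HOL-Algebra.Coset"
    "HOL-Algebra.QuotRing"
    "HOL-Library.Function_Algebras"
    "HOL-Library.Indicator_Function"
    "HOL-Computational_Algebra.Polynomial"
begin

section \<open>Spaces of functions with values in a field\<close>

definition fun_scale :: "'k::field \<Rightarrow> ('a \<Rightarrow> 'k) \<Rightarrow> 'a \<Rightarrow> 'k"
  where "fun_scale c f = (\<lambda>x. c * f x)"

interpretation fun_space: vector_space "fun_scale :: 'k::field \<Rightarrow> ('a \<Rightarrow> 'k) \<Rightarrow> 'a \<Rightarrow> 'k"
  by standard (auto simp: fun_scale_def fun_eq_iff algebra_simps)

definition linear_on ::
    "('k::field \<Rightarrow> 'v::ab_group_add \<Rightarrow> 'v) \<Rightarrow> ('a \<Rightarrow> 'k) set \<Rightarrow> (('a \<Rightarrow> 'k) \<Rightarrow> 'v) \<Rightarrow> bool"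
  where "linear_on scl V \<phi> \<longleftrightarrow>
     (\<forall>f\<in>V. \<forall>g\<in>V. \<phi> (f + g) = \<phi> f + \<phi> g) \<and>
     (\<forall>c. \<forall>f\<in>V. \<phi> (fun_scale c f) = scl c (\<phi> f))"


section \<open>Affine algebraic groups over an algebraically closed field\<close>

text \<open>
  An affine algebraic group is given by its abstract group \<open>G\<close> of rational points together with
  its coordinate ring \<open>R\<close>, a ring of functions on \<open>carrier G\<close>. To make functions on the carrier
  literally equal when they agree on it, every element of \<open>R\<close> is extended by zero outside
  \<open>carrier G\<close>; thus the unit element of \<open>R\<close> is \<open>indicator (carrier G)\<close>.
\<close>

definition pull :: "('g, 'm) monoid_scheme \<Rightarrow> ('g \<Rightarrow> 'g) \<Rightarrow> ('g \<Rightarrow> 'k::field) \<Rightarrow> 'g \<Rightarrow> 'k"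
  where "pull G \<tau> f = (\<lambda>x. if x \<in> carrier G then f (\<tau> x) else 0)"

definition function_algebra :: "'g set \<Rightarrow> ('g \<Rightarrow> 'k::field) set \<Rightarrow> bool"
  where "function_algebra X A \<longleftrightarrow>
     (\<forall>f\<in>A. \<forall>x. x \<notin> X \<longrightarrow> f x = 0) \<and> fun_space.subspace A \<and>
     indicator X \<in> A \<and> (\<forall>f\<in>A. \<forall>g\<in>A. f * g \<in> A)"

definition pure_tensor :: "('g \<Rightarrow> 'k::field) \<Rightarrow> ('g \<Rightarrow> 'k) \<Rightarrow> 'g \<times> 'g \<Rightarrow> 'k"
  where "pure_tensor a b = (\<lambda>(x, y). a x * b y)"

text \<open>
  The tensor product \<open>R \<otimes> R\<close> over the field is identified with its (isomorphic) image in the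
  functions on the product of the carrier with itself. If \<open>B\<close> is a form of \<open>R\<close> over a subfield,
  then the same sums with entries in \<open>B\<close> make up the tensor square of \<open>B\<close> over that subfield.
\<close>

definition tensor_square :: "('g \<Rightarrow> 'k::field) set \<Rightarrow> ('g \<times> 'g \<Rightarrow> 'k) set"
  where "tensor_square A =
     {\<Sum>i<n. pure_tensor (a i) (b i) | (n::nat) a b. \<forall>i<n. a i \<in> A \<and> b i \<in> A}"

definition comult :: "('g, 'm) monoid_scheme \<Rightarrow> ('g \<Rightarrow> 'k::field) \<Rightarrow> 'g \<times> 'g \<Rightarrow> 'k"
  where "comult G f =
     (\<lambda>(x, y). if x \<in> carrier G \<and> y \<in> carrier G then f (x \<otimes>\<^bsub>G\<^esub> y) else 0)"

text \<open>
  The axiom \<open>points\<close> says that \<open>carrier G\<close> is the set of all algebra homomorphisms from \<open>R\<close> to the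
  field, that is, the set of rational points of the affine variety with coordinate ring \<open>R\<close>.
\<close>

locale affine_algebraic_group = group G for G :: "('g, 'm) monoid_scheme" (structure) +
  fixes R :: "('g \<Rightarrow> 'k::alg_closed_field) set"
  assumes algebra: "function_algebra (carrier G) R"
    and finitely_generated:
      "\<exists>S. finite S \<and> S \<subseteq> R \<and> (\<forall>A. function_algebra (carrier G) A \<and> S \<subseteq> A \<longrightarrow> R \<subseteq> A)"
    and separating:
      "\<lbrakk>x \<in> carrier G; y \<in> carrier G; \<And>f. f \<in> R \<Longrightarrow> f x = f y\<rbrakk> \<Longrightarrow> x = y"
    and points:
      "\<lbrakk>linear_on (*) R \<phi>; \<And>f g. f \<in> R \<Longrightarrow> g \<in> R \<Longrightarrow> \<phi> (f * g) = \<phi> f * \<phi> g;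
        \<phi> (indicator (carrier G)) = 1\<rbrakk> \<Longrightarrow> \<exists>x\<in>carrier G. \<forall>f\<in>R. \<phi> f = f x"
    and mult_regular: "f \<in> R \<Longrightarrow> comult G f \<in> tensor_square R"
    and inv_regular: "f \<in> R \<Longrightarrow> pull G (\<lambda>x. inv x) f \<in> R"

definition zariski_closed :: "('g, 'm) monoid_scheme \<Rightarrow> ('g \<Rightarrow> 'k::field) set \<Rightarrow> 'g set \<Rightarrow> bool"
  where "zariski_closed G R C \<longleftrightarrow> (\<exists>S\<subseteq>R. C = {x \<in> carrier G. \<forall>f\<in>S. f x = 0})"

text \<open>The following is only used for closed \<open>C\<close>.\<close>

definition zariski_connected :: "('g, 'm) monoid_scheme \<Rightarrow> ('g \<Rightarrow> 'k::field) set \<Rightarrow> 'g set \<Rightarrow> bool"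
  where "zariski_connected G R C \<longleftrightarrow>
     \<not> (\<exists>A B. zariski_closed G R A \<and> zariski_closed G R B \<and>
          A \<noteq> {} \<and> B \<noteq> {} \<and> A \<inter> B = {} \<and> A \<union> B = C)"

text \<open>An element is unipotent if right translation by it is locally unipotent on \<open>R\<close>.\<close>

definition unipotent_element ::
    "('g, 'm) monoid_scheme \<Rightarrow> ('g \<Rightarrow> 'k::field) set \<Rightarrow> 'g \<Rightarrow> bool"
  where "unipotent_element G R u \<longleftrightarrow>
     (\<forall>f\<in>R. \<exists>n. ((\<lambda>h. pull G (\<lambda>x. x \<otimes>\<^bsub>G\<^esub> u) h - h) ^^ n) f = 0)"

text \<open>
  The group is reductive if its unipotent radical, the largest connected closed normal unipotent
  subgroup, is trivial. The group itself need not be connected.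
\<close>

definition reductive_group :: "('g, 'm) monoid_scheme \<Rightarrow> ('g \<Rightarrow> 'k::alg_closed_field) set \<Rightarrow> bool"
  where "reductive_group G R \<longleftrightarrow> affine_algebraic_group G R \<and>
     (\<forall>N. N \<lhd> G \<and> zariski_closed G R N \<and> zariski_connected G R N \<and>
        (\<forall>u\<in>N. unipotent_element G R u) \<longrightarrow> N = {\<one>\<^bsub>G\<^esub>})"


section \<open>The distribution algebra\<close>

definition augmentation_ideal :: "('g, 'm) monoid_scheme \<Rightarrow> ('g \<Rightarrow> 'k::field) set \<Rightarrow> ('g \<Rightarrow> 'k) set"
  where "augmentation_ideal G R = {f \<in> R. f \<one>\<^bsub>G\<^esub> = 0}"

text \<open>Used for \<open>n \<ge> 1\<close> only, where the linear span of the products is an ideal.\<close>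

definition ideal_power :: "('g \<Rightarrow> 'k::field) set \<Rightarrow> nat \<Rightarrow> ('g \<Rightarrow> 'k) set"
  where "ideal_power I n = fun_space.span {\<Prod>i<n. f i | f. \<forall>i<n. f i \<in> I}"

text \<open>Linear functionals on \<open>R\<close> are extended by zero outside \<open>R\<close>.\<close>

definition Dist_filt ::
    "('g, 'm) monoid_scheme \<Rightarrow> ('g \<Rightarrow> 'k::field) set \<Rightarrow> nat \<Rightarrow> (('g \<Rightarrow> 'k) \<Rightarrow> 'k) set"
  where "Dist_filt G R k =
     {\<mu>. linear_on (*) R \<mu> \<and> (\<forall>f. f \<notin> R \<longrightarrow> \<mu> f = 0) \<and>
         (\<forall>f \<in> ideal_power (augmentation_ideal G R) (k + 1). \<mu> f = 0)}"

definition Dist_plus ::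
    "('g, 'm) monoid_scheme \<Rightarrow> ('g \<Rightarrow> 'k::field) set \<Rightarrow> nat \<Rightarrow> (('g \<Rightarrow> 'k) \<Rightarrow> 'k) set"
  where "Dist_plus G R k = {\<mu> \<in> Dist_filt G R k. \<mu> (indicator (carrier G)) = 0}"

text \<open>
  The functional \<open>\<mu> \<otimes> \<rho>\<close> on the tensor square, obtained by applying \<open>\<rho>\<close> in the second and \<open>\<mu>\<close>
  in the first variable; on pure tensors it is given by the product of the values.
\<close>

definition tensor_functional ::
    "(('g \<Rightarrow> 'k::field) \<Rightarrow> 'k) \<Rightarrow> (('g \<Rightarrow> 'k) \<Rightarrow> 'k) \<Rightarrow> ('g \<times> 'g \<Rightarrow> 'k) \<Rightarrow> 'k"
  where "tensor_functional \<mu> \<rho> F = \<mu> (\<lambda>x. \<rho> (\<lambda>y. F (x, y)))"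

lemma tensor_functional_pure_tensor:
  assumes "linear_on (*) R \<mu>" "linear_on (*) R \<rho>" "a \<in> R" "b \<in> R"
  shows "tensor_functional \<mu> \<rho> (pure_tensor a b) = \<mu> a * \<rho> b"
proof -
  have *: "\<rho> (\<lambda>y. a x * b y) = \<rho> b * a x" for x
    using assms(2,4) by (simp add: linear_on_def fun_scale_def mult.commute)
  have "\<mu> (\<lambda>x. \<rho> b * a x) = \<rho> b * \<mu> a"
    using assms(1,3) by (simp add: linear_on_def fun_scale_def)
  then show ?thesis
    by (simp add: tensor_functional_def pure_tensor_def * mult.commute)
qed

definition dist_mult ::
    "('g, 'm) monoid_scheme \<Rightarrow> ('g \<Rightarrow> 'k::field) set \<Rightarrow>
      (('g \<Rightarrow> 'k) \<Rightarrow> 'k) \<Rightarrow> (('g \<Rightarrow> 'k) \<Rightarrow> 'k) \<Rightarrow> ('g \<Rightarrow> 'k) \<Rightarrow> 'k"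
  where "dist_mult G R \<mu> \<rho> = (\<lambda>f. if f \<in> R then tensor_functional \<mu> \<rho> (comult G f) else 0)"

definition dist_bracket ::
    "('g, 'm) monoid_scheme \<Rightarrow> ('g \<Rightarrow> 'k::field) set \<Rightarrow>
      (('g \<Rightarrow> 'k) \<Rightarrow> 'k) \<Rightarrow> (('g \<Rightarrow> 'k) \<Rightarrow> 'k) \<Rightarrow> ('g \<Rightarrow> 'k) \<Rightarrow> 'k"
  where "dist_bracket G R \<mu> \<rho> = dist_mult G R \<mu> \<rho> - dist_mult G R \<rho> \<mu>"

text \<open>The map induced on distributions by the conjugation \<open>x \<mapsto> g x g\<^sup>-\<^sup>1\<close>.\<close>

definition Ad ::
    "('g, 'm) monoid_scheme \<Rightarrow> ('g \<Rightarrow> 'k::field) set \<Rightarrow> 'g \<Rightarrow>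
      (('g \<Rightarrow> 'k) \<Rightarrow> 'k) \<Rightarrow> ('g \<Rightarrow> 'k) \<Rightarrow> 'k"
  where "Ad G R g \<mu> =
     (\<lambda>f. if f \<in> R then \<mu> (pull G (\<lambda>x. g \<otimes>\<^bsub>G\<^esub> x \<otimes>\<^bsub>G\<^esub> inv\<^bsub>G\<^esub> g) f) else 0)"


section \<open>Tensor algebras\<close>

text \<open>
  Elements of the free associative algebra on a set \<open>V\<close> are finitely supported functions on the
  words over \<open>V\<close>, with the convolution product. The tensor algebra of a vector space \<open>V\<close> is the
  quotient of the free algebra on the underlying set of \<open>V\<close> by the relations which make the
  canonical map from \<open>V\<close> linear.
\<close>

definition free_algebra :: "'v set \<Rightarrow> ('v list \<Rightarrow> 'k::field) ring"
  where "free_algebra V =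
    \<lparr>carrier = {t. finite {w. t w \<noteq> 0} \<and> (\<forall>w. t w \<noteq> 0 \<longrightarrow> set w \<subseteq> V)},
     monoid.mult = (\<lambda>s t w. \<Sum>i\<le>length w. s (take i w) * t (drop i w)),
     one = indicator {[]},
     ring.zero = 0,
     add = (+)\<rparr>"

definition free_gen :: "'v \<Rightarrow> 'v list \<Rightarrow> 'k::field"
  where "free_gen v = indicator {[v]}"

definition free_map :: "('v \<Rightarrow> 'w) \<Rightarrow> ('v list \<Rightarrow> 'k::field) \<Rightarrow> 'w list \<Rightarrow> 'k"
  where "free_map h t = (\<lambda>w'. \<Sum>w | t w \<noteq> 0 \<and> map h w = w'. t w)"

definition tensor_ideal :: "('a \<Rightarrow> 'k::field) set \<Rightarrow> (('a \<Rightarrow> 'k) list \<Rightarrow> 'k) set"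
  where "tensor_ideal V = genideal (free_algebra V)
     ({free_gen (u + v) - free_gen u - free_gen v | u v. u \<in> V \<and> v \<in> V} \<union>
      {free_gen (fun_scale c u) - fun_scale c (free_gen u) | c u. u \<in> V})"

definition tensor_algebra :: "('a \<Rightarrow> 'k::field) set \<Rightarrow> (('a \<Rightarrow> 'k) list \<Rightarrow> 'k) set ring"
  where "tensor_algebra V = free_algebra V Quot tensor_ideal V"

definition tensor_gen ::
    "('a \<Rightarrow> 'k::field) set \<Rightarrow> ('a \<Rightarrow> 'k) \<Rightarrow> (('a \<Rightarrow> 'k) list \<Rightarrow> 'k) set"
  where "tensor_gen V v = tensor_ideal V +>\<^bsub>free_algebra V\<^esub> free_gen v"

text \<open>
  The map that a ring homomorphism \<open>h\<close> to \<open>S\<close> induces from cosets to the quotient of \<open>S\<close> by \<open>J\<close>;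
  the coset of \<open>a\<close> is sent to the coset of \<open>h a\<close>.
\<close>

definition quotient_map :: "'b set \<Rightarrow> ('b, 'n) ring_scheme \<Rightarrow> ('a \<Rightarrow> 'b) \<Rightarrow> 'a set \<Rightarrow> 'b set"
  where "quotient_map J S h X = the_elem ((\<lambda>a. J +>\<^bsub>S\<^esub> h a) ` X)"

text \<open>The homomorphism into the tensor algebra of \<open>V'\<close> induced by a linear map \<open>h\<close> into \<open>V'\<close>.\<close>

definition tensor_map ::
    "('b \<Rightarrow> 'k::field) set \<Rightarrow> (('a \<Rightarrow> 'k) \<Rightarrow> ('b \<Rightarrow> 'k)) \<Rightarrow>
      (('a \<Rightarrow> 'k) list \<Rightarrow> 'k) set \<Rightarrow> (('b \<Rightarrow> 'k) list \<Rightarrow> 'k) set"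
  where "tensor_map V' h = quotient_map (tensor_ideal V') (free_algebra V') (free_map h)"


section \<open>The higher universal enveloping algebras\<close>

definition U_space ::
    "('g, 'm) monoid_scheme \<Rightarrow> ('g \<Rightarrow> 'k::field) set \<Rightarrow> nat \<Rightarrow> (('g \<Rightarrow> 'k) \<Rightarrow> 'k) set"
  where "U_space G R r = Dist_plus G R (CHAR('k) ^ (r + 1) - 1)"

text \<open>
  In the second family the elements are required to lie in \<open>U_space G R r\<close>, as only then the left
  hand side makes sense. This only matters if \<open>i\<close> or \<open>j\<close> is zero, that is, if \<open>x\<close> or \<open>y\<close> is zero.
\<close>

definition U_relations ::
    "('g, 'm) monoid_scheme \<Rightarrow> ('g \<Rightarrow> 'k::field) set \<Rightarrow> nat \<Rightarrow>
      ((('g \<Rightarrow> 'k) \<Rightarrow> 'k) list \<Rightarrow> 'k) set set"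
  where "U_relations G R r =
    (let V = U_space G R r; T = tensor_algebra V; \<iota> = tensor_gen V in
       {\<iota> x \<otimes>\<^bsub>T\<^esub> \<iota> y \<ominus>\<^bsub>T\<^esub> \<iota> (dist_mult G R x y) | x y i j.
          x \<in> Dist_plus G R i \<and> y \<in> Dist_plus G R j \<and> i + j < CHAR('k) ^ (r + 1)} \<union>
       {(\<iota> x \<otimes>\<^bsub>T\<^esub> \<iota> y \<ominus>\<^bsub>T\<^esub> \<iota> y \<otimes>\<^bsub>T\<^esub> \<iota> x) \<ominus>\<^bsub>T\<^esub> \<iota> (dist_bracket G R x y) | x y i j.
          x \<in> Dist_plus G R i \<and> y \<in> Dist_plus G R j \<and> i + j \<le> CHAR('k) ^ (r + 1) \<and>
          x \<in> V \<and> y \<in> V})"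

definition U_ideal ::
    "('g, 'm) monoid_scheme \<Rightarrow> ('g \<Rightarrow> 'k::field) set \<Rightarrow> nat \<Rightarrow>
      ((('g \<Rightarrow> 'k) \<Rightarrow> 'k) list \<Rightarrow> 'k) set set"
  where "U_ideal G R r = genideal (tensor_algebra (U_space G R r)) (U_relations G R r)"

definition U_algebra ::
    "('g, 'm) monoid_scheme \<Rightarrow> ('g \<Rightarrow> 'k::field) set \<Rightarrow> nat \<Rightarrow>
      ((('g \<Rightarrow> 'k) \<Rightarrow> 'k) list \<Rightarrow> 'k) set set ring"
  where "U_algebra G R r = tensor_algebra (U_space G R r) Quot U_ideal G R r"

text \<open>
  The algebra homomorphism into the \<open>r'\<close>-th enveloping algebra which sends the class of \<open>\<delta>\<close> to the
  class of \<open>h \<delta>\<close>.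
\<close>

definition U_map ::
    "('g, 'm) monoid_scheme \<Rightarrow> ('g \<Rightarrow> 'k::field) set \<Rightarrow> nat \<Rightarrow>
      ((('g \<Rightarrow> 'k) \<Rightarrow> 'k) \<Rightarrow> (('g \<Rightarrow> 'k) \<Rightarrow> 'k)) \<Rightarrow>
      ((('g \<Rightarrow> 'k) \<Rightarrow> 'k) list \<Rightarrow> 'k) set set \<Rightarrow> ((('g \<Rightarrow> 'k) \<Rightarrow> 'k) list \<Rightarrow> 'k) set set"
  where "U_map G R r' h =
     quotient_map (U_ideal G R r') (tensor_algebra (U_space G R r')) (tensor_map (U_space G R r') h)"

definition U_action ::
    "('g, 'm) monoid_scheme \<Rightarrow> ('g \<Rightarrow> 'k::field) set \<Rightarrow> nat \<Rightarrow> 'g \<Rightarrow>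
      ((('g \<Rightarrow> 'k) \<Rightarrow> 'k) list \<Rightarrow> 'k) set set \<Rightarrow> ((('g \<Rightarrow> 'k) \<Rightarrow> 'k) list \<Rightarrow> 'k) set set"
  where "U_action G R r g = U_map G R r (Ad G R g)"


section \<open>Forms over the prime field and the geometric Frobenius\<close>

text \<open>
  \<open>B\<close> is a form of the Hopf algebra \<open>R\<close> over the prime field, which is \<open>range of_int\<close> in positive
  characteristic; an additive subgroup is then automatically a subspace over the prime field.
  The last two conditions say that the map from the scalar extension of \<open>B\<close> to \<open>R\<close> is surjective
  and injective, respectively.
\<close>

definition prime_field_form ::
    "('g, 'm) monoid_scheme \<Rightarrow> ('g \<Rightarrow> 'k::field) set \<Rightarrow> ('g \<Rightarrow> 'k) set \<Rightarrow> bool"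
  where "prime_field_form G R B \<longleftrightarrow>
     B \<subseteq> R \<and> indicator (carrier G) \<in> B \<and>
     (\<forall>f\<in>B. \<forall>g\<in>B. f - g \<in> B \<and> f * g \<in> B) \<and>
     (\<forall>f\<in>B. comult G f \<in> tensor_square B) \<and>
     (\<forall>f\<in>B. f \<one>\<^bsub>G\<^esub> \<in> range of_int) \<and>
     (\<forall>f\<in>B. pull G (\<lambda>x. inv\<^bsub>G\<^esub> x) f \<in> B) \<and>
     fun_space.span B = R \<and>
     (\<forall>S\<subseteq>B. finite S \<and>
        (\<forall>c. c ` S \<subseteq> range of_int \<and> (\<Sum>b\<in>S. fun_scale (c b) b) = 0 \<longrightarrow> (\<forall>b\<in>S. c b = 0))
        \<longrightarrow> fun_space.independent S)"

text \<open>The endomorphism \<open>f \<otimes> a \<mapsto> f\<^sup>q \<otimes> a\<close> of \<open>R\<close>, where \<open>q\<close> is the \<open>s\<close>-th power of the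
  characteristic, extended by zero outside \<open>R\<close>.\<close>

definition frob_comorphism ::
    "('g \<Rightarrow> 'k::field) set \<Rightarrow> ('g \<Rightarrow> 'k) set \<Rightarrow> nat \<Rightarrow> ('g \<Rightarrow> 'k) \<Rightarrow> 'g \<Rightarrow> 'k"
  where "frob_comorphism R B s =
     (THE \<phi>. linear_on fun_scale R \<phi> \<and> (\<forall>f. f \<notin> R \<longrightarrow> \<phi> f = 0) \<and>
        (\<forall>f\<in>B. \<phi> f = f ^ (CHAR('k) ^ s)))"

definition geom_frob ::
    "('g, 'm) monoid_scheme \<Rightarrow> ('g \<Rightarrow> 'k::field) set \<Rightarrow> ('g \<Rightarrow> 'k) set \<Rightarrow> nat \<Rightarrow> 'g \<Rightarrow> 'g"
  where "geom_frob G R B s g =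
     (THE h. h \<in> carrier G \<and> (\<forall>f\<in>R. f h = frob_comorphism R B s f g))"

definition dist_frob ::
    "('g \<Rightarrow> 'k::field) set \<Rightarrow> ('g \<Rightarrow> 'k) set \<Rightarrow> nat \<Rightarrow>
      (('g \<Rightarrow> 'k) \<Rightarrow> 'k) \<Rightarrow> ('g \<Rightarrow> 'k) \<Rightarrow> 'k"
  where "dist_frob R B s \<delta> = (\<lambda>f. if f \<in> R then \<delta> (frob_comorphism R B s f) else 0)"

definition Upsilon ::
    "('g, 'm) monoid_scheme \<Rightarrow> ('g \<Rightarrow> 'k::field) set \<Rightarrow> ('g \<Rightarrow> 'k) set \<Rightarrow> nat \<Rightarrow> nat \<Rightarrow>
      ((('g \<Rightarrow> 'k) \<Rightarrow> 'k) list \<Rightarrow> 'k) set set \<Rightarrow> ((('g \<Rightarrow> 'k) \<Rightarrow> 'k) list \<Rightarrow> 'k) set set"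
  where "Upsilon G R B r s = U_map G R (r - s) (dist_frob R B s)"


section \<open>Equivariant maps\<close>

definition frobenius_twist ::
    "('g, 'm) monoid_scheme \<Rightarrow> ('g \<Rightarrow> 'k::field) set \<Rightarrow> ('g \<Rightarrow> 'k) set \<Rightarrow> nat \<Rightarrow>
      ('g \<Rightarrow> 'x \<Rightarrow> 'x) \<Rightarrow> 'g \<Rightarrow> 'x \<Rightarrow> 'x"
  where "frobenius_twist G R B s act = (\<lambda>g. act (geom_frob G R B s g))"

definition equivariant ::
    "('g, 'm) monoid_scheme \<Rightarrow> 'x set \<Rightarrow> ('g \<Rightarrow> 'x \<Rightarrow> 'x) \<Rightarrow>
      'y set \<Rightarrow> ('g \<Rightarrow> 'y \<Rightarrow> 'y) \<Rightarrow> ('x \<Rightarrow> 'y) \<Rightarrow> bool"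
  where "equivariant G X actX Y actY \<phi> \<longleftrightarrow>
     \<phi> \<in> X \<rightarrow> Y \<and> (\<forall>g\<in>carrier G. \<forall>x\<in>X. \<phi> (actX g x) = actY g (\<phi> x))"

end

theory Submission
  imports Defs
begin

text \<open>
  Let \<open>F\<close> be the geometric Frobenius \<open>F\<^sub>g\<^sup>s\<close>, \<open>q = p\<^sup>s\<close>, and \<open>\<Xi>\<close> the map on distributions dual to the comorphism
  of \<open>F\<close>. Since \<open>F\<close> is a group endomorphism, \<open>F (g x g\<^sup>-\<^sup>1) = F g (F x) (F g)\<^sup>-\<^sup>1\<close>, which dually says
  \<open>\<Xi> \<circ> Ad g = Ad (F g) \<circ> \<Xi>\<close>; this identity on generators gives equivariance. That all the maps
  involved descend to the enveloping algebras rests on three facts: the convolution product is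
  filtered with commutative associated graded algebra, \<open>Ad g\<close> preserves the filtration, and \<open>\<Xi>\<close>
  divides filtration degrees by \<open>q\<close>, because the comorphism sends the augmentation ideal into the
  ideal generated by \<open>q\<close>-th powers of its elements.
\<close>


section \<open>Free algebras\<close>

text \<open>Induced maps on quotients pick the common value on all representatives of a coset, so
  they can be computed only once the ideals are known to be respected; hence most of the work
  concerns the defining relations, not the commuting square. Their degree bounds survive because
  floors are superadditive and \<open>q\<close> divides \<open>p ^ (r + 1)\<close>:
  \<open>i + j < p ^ (r + 1)\<close> gives \<open>i div q + j div q < p ^ (r - s + 1)\<close>. The
  weak bound in the commutator relations is where the commutative associated graded algebra comes
  in: a bracket drops one degree and so still lands in degree \<open>p ^ (r + 1) - 1\<close>. The
  comorphism is specified as the linear map that raises elements of the form \<open>B\<close> to the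
  power \<open>q\<close>. Since \<open>B\<close> is only a spanning set, its existence is a claim
  about linear relations over the large field, and here injectivity of the scalar extension enters.
  Orders of vanishing are studied through the action of \<open>R\<close> on functionals,
  \<open>h \<mapsto> \<mu> (f * h)\<close>: a functional kills the power \<open>n + 1\<close> of the
  augmentation ideal iff every \<open>f\<close> in that ideal moves it to one that kills the power
  \<open>n\<close>.\<close>

lemma sum_fun_apply: "(\<Sum>i\<in>A. f i) x = (\<Sum>i\<in>A. f i x)"
  by (induction A rule: infinite_finite_induct) auto

lemma fun_scale_apply [simp]: "fun_scale c f x = c * f x"
  by (simp add: fun_scale_def)

lemma free_algebra_simps:
  "carrier (free_algebra V) = {t. finite {w. t w \<noteq> 0} \<and> (\<forall>w. t w \<noteq> 0 \<longrightarrow> set w \<subseteq> V)}"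
  "s \<otimes>\<^bsub>free_algebra V\<^esub> t = (\<lambda>w. \<Sum>i\<le>length w. s (take i w) * t (drop i w))"
  "\<one>\<^bsub>free_algebra V\<^esub> = indicator {[]}"
  "\<zero>\<^bsub>free_algebra V\<^esub> = 0"
  "s \<oplus>\<^bsub>free_algebra V\<^esub> t = s + t"
  by (simp_all add: free_algebra_def)

text \<open>
  Pairing with arbitrary functions \<open>\<phi>\<close> on words turns the convolution product into
  concatenation of arguments, which makes the algebra laws immediate.
\<close>

definition word_pairing :: "('v list \<Rightarrow> 'k::field) \<Rightarrow> ('v list \<Rightarrow> 'k) \<Rightarrow> 'k"
  where "word_pairing t \<phi> = (\<Sum>w | t w \<noteq> 0. t w * \<phi> w)"

lemma word_pairing_superset:
  assumes "finite T" "{w. t w \<noteq> 0} \<subseteq> T"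
  shows "word_pairing t \<phi> = (\<Sum>w\<in>T. t w * \<phi> w)"
  unfolding word_pairing_def using assms by (intro sum.mono_neutral_left) auto

lemma word_pairing_delta:
  assumes "finite {w. t w \<noteq> 0}"
  shows "word_pairing t (\<lambda>v. if v = w then 1 else 0) = t w"
  using assms by (auto simp: word_pairing_def if_distrib sum.delta cong: if_cong)

text \<open>Testing against point masses recovers every coefficient. Finite support matters, because
  a sum over an infinite set is 0 by convention.\<close>

lemma word_pairing_eqI:
  assumes "finite {w. s w \<noteq> 0}" "finite {w. t w \<noteq> 0}"
    and "\<And>\<phi>. word_pairing s \<phi> = word_pairing t \<phi>"
  shows "s = t"
  using word_pairing_delta[OF assms(1)] word_pairing_delta[OF assms(2)] assms(3)
  by (metis ext)

lemma word_pairing_one: "word_pairing (indicator {[]}) \<phi> = \<phi> []"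
  by (subst word_pairing_superset[of "{[]}"]) (auto simp: indicator_def)

lemma support_mult:
  fixes s t :: "'v list \<Rightarrow> 'k::field"
  shows "{w. (s \<otimes>\<^bsub>free_algebra V\<^esub> t) w \<noteq> 0} \<subseteq> (\<lambda>(u, v). u @ v) ` ({w. s w \<noteq> 0} \<times> {w. t w \<noteq> 0})"
proof
  fix w assume "w \<in> {w. (s \<otimes>\<^bsub>free_algebra V\<^esub> t) w \<noteq> 0}"
  then have "(\<Sum>i\<le>length w. s (take i w) * t (drop i w)) \<noteq> 0"
    by (simp add: free_algebra_simps)
  then obtain i where "s (take i w) * t (drop i w) \<noteq> 0"
    by (meson sum.neutral)
  then show "w \<in> (\<lambda>(u, v). u @ v) ` ({w. s w \<noteq> 0} \<times> {w. t w \<noteq> 0})"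
    by (intro image_eqI[of _ _ "(take i w, drop i w)"]) auto
qed

text \<open>Cutting \<open>w\<close> at position \<open>i\<close> amounts to a factorisation
  \<open>w = u @ v\<close>. The index sets \<open>S\<close> and \<open>T\<close> do not depend on
  \<open>w\<close>, so that a later sum over \<open>w\<close> can be moved inside.\<close>

lemma convolution_eq_sum_pairs:
  fixes s t :: "'v list \<Rightarrow> 'k::field"
  assumes "finite S" "{w. s w \<noteq> 0} \<subseteq> S" "finite T" "{w. t w \<noteq> 0} \<subseteq> T"
  shows "(s \<otimes>\<^bsub>free_algebra V\<^esub> t) w = (\<Sum>u\<in>S. \<Sum>v\<in>T. if u @ v = w then s u * t v else 0)"
proof -
  have bij: "bij_betw (\<lambda>i. (take i w, drop i w)) {..length w} {(u, v). u @ v = w}"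
    by (rule bij_betw_byWitness[of _ "\<lambda>(u, v). length u"]) (auto simp: min_def)
  then have fin: "finite {(u, v). u @ v = w}"
    using bij_betw_finite by blast
  have "(s \<otimes>\<^bsub>free_algebra V\<^esub> t) w = (\<Sum>(u, v) | u @ v = w. s u * t v)"
    using sum.reindex_bij_betw[OF bij, of "\<lambda>(u, v). s u * t v"]
    by (simp add: free_algebra_simps)
  also have "\<dots> = (\<Sum>(u, v)\<in>{(u, v). u @ v = w} \<inter> S \<times> T. s u * t v)"
    using fin assms by (intro sum.mono_neutral_right) auto
  also have "\<dots> = (\<Sum>(u, v)\<in>S \<times> T. if u @ v = w then s u * t v else 0)"
    using assms by (intro sum.mono_neutral_cong_left) (auto split: if_splits)
  also have "\<dots> = (\<Sum>u\<in>S. \<Sum>v\<in>T. if u @ v = w then s u * t v else 0)"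
    by (simp add: sum.cartesian_product)
  finally show ?thesis .
qed

lemma word_pairing_mult:
  assumes s: "finite {w. s w \<noteq> 0}" and t: "finite {w. t w \<noteq> 0}"
  shows "word_pairing (s \<otimes>\<^bsub>free_algebra V\<^esub> t) \<phi> = word_pairing s (\<lambda>u. word_pairing t (\<lambda>v. \<phi> (u @ v)))"
proof -
  define S where "S = {w. s w \<noteq> 0}"
  define T where "T = {w. t w \<noteq> 0}"
  define W where "W = (\<lambda>(u, v). u @ v) ` (S \<times> T)"
  have fin: "finite S" "finite T" "finite W"
    using s t by (auto simp: S_def T_def W_def)
  have "word_pairing (s \<otimes>\<^bsub>free_algebra V\<^esub> t) \<phi> = (\<Sum>w\<in>W. (s \<otimes>\<^bsub>free_algebra V\<^esub> t) w * \<phi> w)"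
    using fin unfolding W_def S_def T_def by (intro word_pairing_superset support_mult)
  also have "\<dots> = (\<Sum>w\<in>W. \<Sum>u\<in>S. \<Sum>v\<in>T. if u @ v = w then s u * t v * \<phi> w else 0)"
    by (intro sum.cong refl, subst convolution_eq_sum_pairs[of S s T t])
      (use s t in \<open>auto simp: S_def T_def sum_distrib_right intro!: sum.cong\<close>)
  also have "\<dots> = (\<Sum>u\<in>S. \<Sum>v\<in>T. \<Sum>w\<in>W. if u @ v = w then s u * t v * \<phi> w else 0)"
    unfolding sum.swap[of _ S W] sum.swap[of _ T W] ..
  also have "\<dots> = (\<Sum>u\<in>S. \<Sum>v\<in>T. s u * t v * \<phi> (u @ v))"
    using fin by (intro sum.cong refl) (auto simp: sum.delta' W_def intro!: rev_image_eqI)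
  also have "\<dots> = word_pairing s (\<lambda>u. word_pairing t (\<lambda>v. \<phi> (u @ v)))"
    by (simp add: word_pairing_def S_def T_def sum_distrib_left mult.assoc)
  finally show ?thesis .
qed

lemma free_algebra_mult_closed:
  assumes "s \<in> carrier (free_algebra V)" "t \<in> carrier (free_algebra V)"
  shows "s \<otimes>\<^bsub>free_algebra V\<^esub> t \<in> carrier (free_algebra V)"
proof -
  have "finite {w. (s \<otimes>\<^bsub>free_algebra V\<^esub> t) w \<noteq> 0}"
    using assms by (intro finite_subset[OF support_mult]) (auto simp: free_algebra_simps(1))
  moreover have "set w \<subseteq> V" if "(s \<otimes>\<^bsub>free_algebra V\<^esub> t) w \<noteq> 0" for w
  proof -
    have "w \<in> (\<lambda>(u, v). u @ v) ` ({w. s w \<noteq> 0} \<times> {w. t w \<noteq> 0})"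
      using support_mult that by blast
    then obtain u v where "s u \<noteq> 0" "t v \<noteq> 0" "w = u @ v"
      by auto
    with assms show ?thesis
      by (auto simp: free_algebra_simps(1))
  qed
  ultimately show ?thesis
    by (simp add: free_algebra_simps(1))
qed

lemma free_algebra_add_closed:
  assumes "s \<in> carrier (free_algebra V)" "t \<in> carrier (free_algebra V)"
  shows "s + t \<in> carrier (free_algebra V)"
proof -
  have *: "s w \<noteq> 0 \<or> t w \<noteq> 0" if "(s + t) w \<noteq> 0" for w
    using that by auto
  then have "{w. (s + t) w \<noteq> 0} \<subseteq> {w. s w \<noteq> 0} \<union> {w. t w \<noteq> 0}"
    by blast
  then have "finite {w. (s + t) w \<noteq> 0}"
    using assms by (rule_tac finite_subset) (auto simp: free_algebra_simps(1))
  with * assms show ?thesis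
    unfolding free_algebra_simps(1) by blast
qed

lemma free_algebra_scale_closed:
  assumes "t \<in> carrier (free_algebra V)"
  shows "fun_scale c t \<in> carrier (free_algebra V)"
proof -
  have "{w. fun_scale c t w \<noteq> 0} \<subseteq> {w. t w \<noteq> 0}"
    by auto
  then show ?thesis
    using assms finite_subset unfolding free_algebra_simps(1) by auto
qed

lemma fun_scale_minus_one: "fun_scale (- 1) f = - f"
  by (simp add: fun_eq_iff)

lemma free_algebra_diff_closed:
  assumes "s \<in> carrier (free_algebra V)" "t \<in> carrier (free_algebra V)"
  shows "s - t \<in> carrier (free_algebra V)"
  using free_algebra_add_closed[OF assms(1) free_algebra_scale_closed[OF assms(2), of "- 1"]]
  by (simp add: fun_scale_minus_one)

lemma free_gen_closed: "v \<in> V \<Longrightarrow> free_gen v \<in> carrier (free_algebra V)"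
  by (auto simp: free_algebra_simps(1) free_gen_def indicator_def)

lemma ring_free_algebra: "ring (free_algebra V :: ('v list \<Rightarrow> 'k::field) ring)"
proof (rule ringI)
  let ?A = "free_algebra V :: ('v list \<Rightarrow> 'k) ring"
  have zero: "0 \<in> carrier ?A"
    by (simp add: free_algebra_simps)
  show "abelian_group ?A"
  proof (rule abelian_groupI)
    fix t assume "t \<in> carrier ?A"
    then have "0 - t \<in> carrier ?A"
      using zero by (rule_tac free_algebra_diff_closed)
    then show "\<exists>s\<in>carrier ?A. s \<oplus>\<^bsub>?A\<^esub> t = \<zero>\<^bsub>?A\<^esub>"
      by (intro bexI[of _ "0 - t"]) (auto simp: free_algebra_simps(4,5))
  qed (use zero in \<open>auto simp: free_algebra_simps(4,5) free_algebra_add_closed add_ac\<close>)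
  have fin: "finite {w. t w \<noteq> 0}" if "t \<in> carrier ?A" for t
    using that by (simp add: free_algebra_simps(1))
  show "monoid ?A"
  proof (rule monoidI)
    show one: "\<one>\<^bsub>?A\<^esub> \<in> carrier ?A"
      by (simp add: free_algebra_simps indicator_def)
    fix s assume s: "s \<in> carrier ?A"
    show "\<one>\<^bsub>?A\<^esub> \<otimes>\<^bsub>?A\<^esub> s = s" "s \<otimes>\<^bsub>?A\<^esub> \<one>\<^bsub>?A\<^esub> = s"
      using one s free_algebra_mult_closed[OF s one] free_algebra_mult_closed[OF one s]
      by (auto intro!: word_pairing_eqI simp: fin word_pairing_mult word_pairing_one free_algebra_simps(3))
    fix t assume t: "t \<in> carrier ?A"
    then show "s \<otimes>\<^bsub>?A\<^esub> t \<in> carrier ?A"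
      using s by (rule_tac free_algebra_mult_closed)
    fix u assume u: "u \<in> carrier ?A"
    show "(s \<otimes>\<^bsub>?A\<^esub> t) \<otimes>\<^bsub>?A\<^esub> u = s \<otimes>\<^bsub>?A\<^esub> (t \<otimes>\<^bsub>?A\<^esub> u)"
      using s t u
      by (intro word_pairing_eqI) (simp_all add: fin free_algebra_mult_closed word_pairing_mult)
  qed
qed (simp_all add: free_algebra_simps fun_eq_iff algebra_simps sum.distrib)

section \<open>Functoriality of the free algebra\<close>

lemma free_map_superset:
  assumes "finite T" "{w. t w \<noteq> 0} \<subseteq> T"
  shows "free_map h t w' = (\<Sum>w\<in>T. if map h w = w' then t w else 0)"
  unfolding free_map_def using assms by (intro sum.mono_neutral_cong_left) auto

lemma support_free_map: "{w'. free_map h t w' \<noteq> 0} \<subseteq> map h ` {w. t w \<noteq> 0}"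
proof
  fix w' assume "w' \<in> {w'. free_map h t w' \<noteq> 0}"
  then have "(\<Sum>w | t w \<noteq> 0 \<and> map h w = w'. t w) \<noteq> 0"
    by (simp add: free_map_def)
  then obtain w where "t w \<noteq> 0" "map h w = w'"
    by (metis (mono_tags, lifting) mem_Collect_eq sum.neutral)
  then show "w' \<in> map h ` {w. t w \<noteq> 0}"
    by auto
qed

lemma free_map_closed:
  assumes "t \<in> carrier (free_algebra V)" "h ` V \<subseteq> V'"
  shows "free_map h t \<in> carrier (free_algebra V')"
proof -
  have "finite {w. free_map h t w \<noteq> 0}"
    using assms by (intro finite_subset[OF support_free_map]) (auto simp: free_algebra_simps(1))
  moreover have "set w \<subseteq> V'" if "free_map h t w \<noteq> 0" for w
  proof -
    have "w \<in> map h ` {w. t w \<noteq> 0}"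
      using support_free_map that by blast
    then obtain v where "t v \<noteq> 0" "w = map h v"
      by auto
    with assms show ?thesis
      by (fastforce simp: free_algebra_simps(1))
  qed
  ultimately show ?thesis
    by (simp add: free_algebra_simps(1))
qed

text \<open>This is the change of variables formula for the push-forward of a finitely supported
  measure on words. Multiplicativity of \<open>free_map h\<close> then comes down to the fact that
  \<open>map h\<close> respects concatenation.\<close>

lemma word_pairing_free_map:
  assumes t: "finite {w. t w \<noteq> 0}"
  shows "word_pairing (free_map h t) \<phi> = word_pairing t (\<lambda>w. \<phi> (map h w))"
proof -
  define T where "T = {w. t w \<noteq> 0}"
  have T: "finite T" "{w. t w \<noteq> 0} \<subseteq> T"
    using t by (auto simp: T_def)
  have "word_pairing (free_map h t) \<phi> = (\<Sum>w'\<in>map h ` T. free_map h t w' * \<phi> w')"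
    using T support_free_map unfolding T_def by (intro word_pairing_superset) auto
  also have "\<dots> = (\<Sum>w'\<in>map h ` T. \<Sum>w\<in>T. if map h w = w' then t w * \<phi> w' else 0)"
    by (intro sum.cong refl, subst free_map_superset[OF T])
      (auto simp: sum_distrib_right intro!: sum.cong)
  also have "\<dots> = (\<Sum>w\<in>T. \<Sum>w'\<in>map h ` T. if map h w = w' then t w * \<phi> w' else 0)"
    by (rule sum.swap)
  also have "\<dots> = (\<Sum>w\<in>T. t w * \<phi> (map h w))"
    using T(1) by (intro sum.cong refl) (auto simp: sum.delta')
  finally show ?thesis
    by (simp add: word_pairing_def T_def)
qed

lemma free_map_add:
  assumes "finite {w. s w \<noteq> 0}" "finite {w. t w \<noteq> 0}"
  shows "free_map h (s + t) = free_map h s + free_map h t"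
proof
  fix w
  let ?T = "{w. s w \<noteq> 0} \<union> {w. t w \<noteq> 0}"
  have *: "finite ?T" "{w. (s + t) w \<noteq> 0} \<subseteq> ?T" "{w. s w \<noteq> 0} \<subseteq> ?T" "{w. t w \<noteq> 0} \<subseteq> ?T"
    using assms by auto
  show "free_map h (s + t) w = (free_map h s + free_map h t) w"
    unfolding plus_fun_apply free_map_superset[OF *(1,2)] free_map_superset[OF *(1,3)]
      free_map_superset[OF *(1,4)]
    by (subst sum.distrib[symmetric]) (auto intro!: sum.cong)
qed

lemma free_map_scale:
  assumes "finite {w. t w \<noteq> 0}"
  shows "free_map h (fun_scale c t) = fun_scale c (free_map h t)"
proof
  fix w
  have "{w. fun_scale c t w \<noteq> 0} \<subseteq> {w. t w \<noteq> 0}"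
    by auto
  then show "free_map h (fun_scale c t) w = fun_scale c (free_map h t) w"
    using free_map_superset[of "{w. t w \<noteq> 0}" "fun_scale c t" h w]
      free_map_superset[of "{w. t w \<noteq> 0}" t h w] assms
    by (auto simp: sum_distrib_left intro!: sum.cong)
qed

lemma free_map_diff:
  assumes "s \<in> carrier (free_algebra V)" "t \<in> carrier (free_algebra V)"
  shows "free_map h (s - t) = free_map h s - free_map h t"
proof -
  have "fun_scale (- 1) t \<in> carrier (free_algebra V)"
    using assms by (rule_tac free_algebra_scale_closed)
  then have "free_map h (s + fun_scale (- 1) t) = free_map h s + fun_scale (- 1) (free_map h t)"
    using assms
    by (subst free_map_add) (simp_all only: free_algebra_simps(1) mem_Collect_eq free_map_scale)
  then show ?thesis
    by (simp add: fun_scale_minus_one)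
qed

lemma free_map_free_gen: "free_map h (free_gen v) = free_gen (h v)"
  by (rule ext, subst free_map_superset[of "{[v]}"]) (auto simp: free_gen_def indicator_def)

text \<open>Together with \<open>free_map_cong\<close> this reduces the final commuting square to an
  identity between two maps on generators.\<close>

lemma free_map_comp:
  assumes "t \<in> carrier (free_algebra V)"
  shows "free_map k (free_map h t) = free_map (\<lambda>v. k (h v)) t"
proof (rule word_pairing_eqI)
  have "free_map h t \<in> carrier (free_algebra (h ` V))"
    using assms free_map_closed by blast
  then show fin: "finite {w. free_map k (free_map h t) w \<noteq> 0}"
    using free_map_closed[of "free_map h t" "h ` V" k "k ` h ` V"] by (simp add: free_algebra_simps(1))
  show "finite {w. free_map (\<lambda>v. k (h v)) t w \<noteq> 0}"
    using free_map_closed[OF assms order.refl, of "\<lambda>v. k (h v)"] by (simp add: free_algebra_simps(1))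
  show "word_pairing (free_map k (free_map h t)) \<phi> = word_pairing (free_map (\<lambda>v. k (h v)) t) \<phi>" for \<phi>
    using assms free_map_closed[OF assms order.refl, of h]
    by (subst word_pairing_free_map)
      (auto simp: word_pairing_free_map free_algebra_simps(1) comp_def)
qed

lemma free_map_cong:
  assumes "t \<in> carrier (free_algebra V)" "\<And>v. v \<in> V \<Longrightarrow> h v = k v"
  shows "free_map h t = free_map k t"
proof
  fix w'
  have "map h w = map k w" if "t w \<noteq> 0" for w
    using that assms by (auto simp: free_algebra_simps(1) subset_iff)
  then have "{w. t w \<noteq> 0 \<and> map h w = w'} = {w. t w \<noteq> 0 \<and> map k w = w'}"
    by auto
  then show "free_map h t w' = free_map k t w'"
    by (simp add: free_map_def)
qed

lemma free_map_ring_hom: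
  assumes "h ` V \<subseteq> V'"
  shows "ring_hom_ring (free_algebra V) (free_algebra V') (free_map h :: ('v list \<Rightarrow> 'k::field) \<Rightarrow> _)"
proof (rule ring_hom_ringI[OF ring_free_algebra ring_free_algebra])
  let ?A = "free_algebra V :: ('v list \<Rightarrow> 'k) ring"
  have fin: "finite {w. t w \<noteq> 0}" if "t \<in> carrier (free_algebra V)" for t :: "'u list \<Rightarrow> 'k" and V
    using that by (simp add: free_algebra_simps(1))
  show closed: "free_map h t \<in> carrier (free_algebra V')" if "t \<in> carrier ?A" for t
    using free_map_closed[OF that assms] .
  show "free_map h (s \<otimes>\<^bsub>?A\<^esub> t) = free_map h s \<otimes>\<^bsub>free_algebra V'\<^esub> free_map h t"
    if "s \<in> carrier ?A" "t \<in> carrier ?A" for s t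
    using that
    by (intro word_pairing_eqI fin[of _ V'] closed free_algebra_mult_closed)
      (simp_all add: word_pairing_mult word_pairing_free_map fin[of _ V] fin[of _ V'] closed
        free_algebra_mult_closed)
  show "free_map h (s \<oplus>\<^bsub>?A\<^esub> t) = free_map h s \<oplus>\<^bsub>free_algebra V'\<^esub> free_map h t"
    if "s \<in> carrier ?A" "t \<in> carrier ?A" for s t
    using that by (simp add: free_algebra_simps free_map_add)
  show "free_map h \<one>\<^bsub>?A\<^esub> = \<one>\<^bsub>free_algebra V'\<^esub>"
    unfolding free_algebra_simps(3)
    by (rule ext, subst free_map_superset[of "{[]}"]) (auto simp: indicator_def)
qed


section \<open>Induced maps on quotients and tensor algebras\<close>

text \<open>Two representatives differ by an element of \<open>I\<close>, which \<open>h\<close>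
  sends into \<open>J\<close>; so the image of the coset is a singleton, and only on singletons does
  \<open>the_elem\<close> return anything meaningful.\<close>

lemma quotient_map_coset:
  assumes "ring_hom_ring A S h" "ideal I A" "ideal J S" "h ` I \<subseteq> J" "a \<in> carrier A"
  shows "quotient_map J S h (I +>\<^bsub>A\<^esub> a) = J +>\<^bsub>S\<^esub> h a"
proof -
  interpret h: ring_hom_ring A S h by fact
  interpret I: ideal I A by fact
  interpret J: ideal J S by fact
  have "J +>\<^bsub>S\<^esub> h b = J +>\<^bsub>S\<^esub> h a" if b: "b \<in> I +>\<^bsub>A\<^esub> a" for b
  proof -
    obtain i where i: "i \<in> I" "b = i \<oplus>\<^bsub>A\<^esub> a"
      using b by (auto simp: a_r_coset_def')
    then have "h b = h i \<oplus>\<^bsub>S\<^esub> h a"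
      using I.Icarr assms(5) by auto
    moreover have "h i \<in> J"
      using i assms(4) by auto
    ultimately have "h b \<in> J +>\<^bsub>S\<^esub> h a"
      unfolding a_r_coset_def' by blast
    then show ?thesis
      by (rule J.a_repr_independence'[symmetric]) (use assms(5) in simp)
  qed
  moreover have "a \<in> I +>\<^bsub>A\<^esub> a"
    using I.a_rcos_self[OF assms(5)] .
  ultimately have "(\<lambda>a. J +>\<^bsub>S\<^esub> h a) ` (I +>\<^bsub>A\<^esub> a) = {J +>\<^bsub>S\<^esub> h a}"
    by blast
  then show ?thesis
    by (simp add: quotient_map_def)
qed

lemma quotient_carrierE:
  assumes "X \<in> carrier (A Quot I)"
  obtains a where "a \<in> carrier A" "X = I +>\<^bsub>A\<^esub> a"
  using assms by (auto simp: FactRing_def A_RCOSETS_def')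

lemma quotient_map_ring_hom:
  assumes "ring_hom_ring A S h" "ideal I A" "ideal J S" "h ` I \<subseteq> J"
  shows "ring_hom_ring (A Quot I) (S Quot J) (quotient_map J S h)"
proof -
  interpret h: ring_hom_ring A S h by fact
  interpret I: ideal I A by fact
  interpret J: ideal J S by fact
  interpret pI: ring_hom_ring A "A Quot I" "(+>\<^bsub>A\<^esub>) I" by (rule I.rcos_ring_hom_ring)
  interpret pJ: ring_hom_ring S "S Quot J" "(+>\<^bsub>S\<^esub>) J" by (rule J.rcos_ring_hom_ring)
  note coset = quotient_map_coset[OF assms]
  show ?thesis
  proof (rule ring_hom_ringI[OF I.quotient_is_ring J.quotient_is_ring])
    fix X assume "X \<in> carrier (A Quot I)"
    then obtain a where a: "a \<in> carrier A" "X = I +>\<^bsub>A\<^esub> a"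
      by (rule quotient_carrierE)
    then show "quotient_map J S h X \<in> carrier (S Quot J)"
      by (simp add: coset)
    fix Y assume "Y \<in> carrier (A Quot I)"
    then obtain b where b: "b \<in> carrier A" "Y = I +>\<^bsub>A\<^esub> b"
      by (rule quotient_carrierE)
    show "quotient_map J S h (X \<otimes>\<^bsub>A Quot I\<^esub> Y) =
        quotient_map J S h X \<otimes>\<^bsub>S Quot J\<^esub> quotient_map J S h Y"
      using a b by (simp add: coset flip: pI.hom_mult pJ.hom_mult)
    show "quotient_map J S h (X \<oplus>\<^bsub>A Quot I\<^esub> Y) =
        quotient_map J S h X \<oplus>\<^bsub>S Quot J\<^esub> quotient_map J S h Y"
      using a b by (simp add: coset flip: pI.hom_add pJ.hom_add)
  next
    show "quotient_map J S h \<one>\<^bsub>A Quot I\<^esub> = \<one>\<^bsub>S Quot J\<^esub>"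
      using coset[of "\<one>\<^bsub>A\<^esub>"] by (simp flip: pI.hom_one pJ.hom_one)
  qed
qed

text \<open>The preimage of an ideal is an ideal, so it is enough to check generators. This serves
  both layers of quotients, the tensor ideal and the ideal of the enveloping algebra.\<close>

lemma (in ring_hom_ring) image_genideal_subset:
  assumes "X \<subseteq> carrier R" "h ` X \<subseteq> J" "ideal J S"
  shows "h ` genideal R X \<subseteq> J"
proof -
  have "genideal R X \<subseteq> {r \<in> carrier R. h r \<in> J}"
    using assms by (intro R.genideal_minimal ideal_vimage) auto
  then show ?thesis
    by auto
qed

section \<open>Functoriality of the tensor algebra\<close>

lemma linear_onD:
  assumes "linear_on scl V \<phi>"
  shows "f \<in> V \<Longrightarrow> g \<in> V \<Longrightarrow> \<phi> (f + g) = \<phi> f + \<phi> g"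
    and "f \<in> V \<Longrightarrow> \<phi> (fun_scale c f) = scl c (\<phi> f)"
  using assms by (auto simp: linear_on_def)

definition tensor_relations :: "('a \<Rightarrow> 'k::field) set \<Rightarrow> (('a \<Rightarrow> 'k) list \<Rightarrow> 'k) set"
  where "tensor_relations V =
     {free_gen (u + v) - free_gen u - free_gen v | u v. u \<in> V \<and> v \<in> V} \<union>
     {free_gen (fun_scale c u) - fun_scale c (free_gen u) | c u. u \<in> V}"

lemma tensor_relations_subset:
  assumes "fun_space.subspace V"
  shows "tensor_relations V \<subseteq> carrier (free_algebra V)"
  using fun_space.subspace_add[OF assms] fun_space.subspace_scale[OF assms]
  by (auto simp: tensor_relations_def
      intro!: free_algebra_diff_closed free_algebra_scale_closed free_gen_closed)

lemma tensor_ideal_eq: "tensor_ideal V = genideal (free_algebra V) (tensor_relations V)"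
  by (simp add: tensor_ideal_def tensor_relations_def)

lemma ideal_tensor_ideal:
  assumes "fun_space.subspace V"
  shows "ideal (tensor_ideal V) (free_algebra V)"
  unfolding tensor_ideal_eq
  using ring.genideal_ideal[OF ring_free_algebra tensor_relations_subset[OF assms]] .

lemma ring_tensor_algebra: "fun_space.subspace V \<Longrightarrow> ring (tensor_algebra V)"
  unfolding tensor_algebra_def by (intro ideal.quotient_is_ring ideal_tensor_ideal)

text \<open>Linearity of \<open>h\<close> is exactly what turns the relation attached to
  \<open>u, v\<close> or to \<open>c, u\<close> into the relation of the same shape attached to the
  images.\<close>

lemma free_map_tensor_relations:
  fixes V :: "('a \<Rightarrow> 'k::field) set"
  assumes V: "fun_space.subspace V" and lin: "linear_on fun_scale V h" and sub: "h ` V \<subseteq> V'"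
  shows "free_map h ` tensor_relations V \<subseteq> tensor_relations V'"
proof -
  note V' = fun_space.subspace_add[OF V] fun_space.subspace_scale[OF V]
  have 1: "free_map h (free_gen (u + v) - free_gen u - free_gen v) \<in> tensor_relations V'"
    if "u \<in> V" "v \<in> V" for u v
  proof -
    have "free_map h (free_gen (u + v) - free_gen u - free_gen v)
        = free_gen (h u + h v) - free_gen (h u) - free_gen (h v)"
      using that
      by (simp add: free_map_diff[of _ V] free_gen_closed free_algebra_diff_closed V'
          free_map_free_gen linear_onD[OF lin])
    with that sub show ?thesis
      unfolding tensor_relations_def by blast
  qed
  have 2: "free_map h (free_gen (fun_scale c u) - fun_scale c (free_gen u)) \<in> tensor_relations V'"
    if "u \<in> V" for c u
  proof -
    have "finite {w. free_gen u w \<noteq> (0::'k)}"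
      using free_gen_closed[OF that] by (auto simp: free_algebra_simps(1))
    then have "free_map h (free_gen (fun_scale c u) - fun_scale c (free_gen u))
        = free_gen (fun_scale c (h u)) - fun_scale c (free_gen (h u))"
      using that
      by (simp add: free_map_diff[of _ V] free_gen_closed free_algebra_scale_closed V'
          free_map_free_gen free_map_scale linear_onD[OF lin])
    with that sub show ?thesis
      unfolding tensor_relations_def by blast
  qed
  show ?thesis
    using 1 2 by (auto simp: tensor_relations_def[of V])
qed

context
  fixes V :: "('a \<Rightarrow> 'k::field) set" and V' :: "('b \<Rightarrow> 'k) set" and h
  assumes V: "fun_space.subspace V" and V': "fun_space.subspace V'"
    and lin: "linear_on fun_scale V h" and sub: "h ` V \<subseteq> V'"
begin

lemma free_map_tensor_ideal: "free_map h ` tensor_ideal V \<subseteq> tensor_ideal V'"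
proof -
  interpret ring_hom_ring "free_algebra V" "free_algebra V'" "free_map h"
    by (rule free_map_ring_hom[OF sub])
  have "tensor_relations V' \<subseteq> tensor_ideal V'"
    unfolding tensor_ideal_eq
    by (rule ring.genideal_self[OF ring_free_algebra tensor_relations_subset[OF V']])
  then show ?thesis
    unfolding tensor_ideal_eq[of V]
    using image_genideal_subset[OF tensor_relations_subset[OF V] _ ideal_tensor_ideal[OF V']]
      free_map_tensor_relations[OF V lin sub] by blast
qed

lemma tensor_map_ring_hom: "ring_hom_ring (tensor_algebra V) (tensor_algebra V') (tensor_map V' h)"
  unfolding tensor_algebra_def tensor_map_def
  by (intro quotient_map_ring_hom free_map_ring_hom ideal_tensor_ideal free_map_tensor_ideal V V' sub)

lemma tensor_map_coset:
  "t \<in> carrier (free_algebra V) \<Longrightarrow>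
    tensor_map V' h (tensor_ideal V +>\<^bsub>free_algebra V\<^esub> t) = tensor_ideal V' +>\<^bsub>free_algebra V'\<^esub> free_map h t"
  unfolding tensor_map_def
  by (intro quotient_map_coset free_map_ring_hom ideal_tensor_ideal free_map_tensor_ideal V V' sub)

lemma tensor_map_gen: "v \<in> V \<Longrightarrow> tensor_map V' h (tensor_gen V v) = tensor_gen V' (h v)"
  by (simp add: tensor_gen_def tensor_map_coset free_gen_closed free_map_free_gen)

end

lemma tensor_gen_closed:
  assumes "fun_space.subspace V" "v \<in> V"
  shows "tensor_gen V v \<in> carrier (tensor_algebra V)"
proof -
  interpret ideal "tensor_ideal V" "free_algebra V"
    by (rule ideal_tensor_ideal[OF assms(1)])
  interpret ring_hom_ring "free_algebra V" "tensor_algebra V" "(+>\<^bsub>free_algebra V\<^esub>) (tensor_ideal V)"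
    unfolding tensor_algebra_def by (rule rcos_ring_hom_ring)
  show ?thesis
    unfolding tensor_gen_def using assms(2) by (intro hom_closed free_gen_closed)
qed


section \<open>Distributions on an affine algebraic group\<close>

context affine_algebraic_group
begin

abbreviation unit_function :: "'g \<Rightarrow> 'k"
  where "unit_function \<equiv> indicator (carrier G)"

lemma regular_outside: "f \<in> R \<Longrightarrow> x \<notin> carrier G \<Longrightarrow> f x = 0"
  using algebra by (auto simp: function_algebra_def)

lemma regular_subspace: "fun_space.subspace R"
  using algebra by (auto simp: function_algebra_def)

lemma unit_regular: "unit_function \<in> R"
  using algebra by (auto simp: function_algebra_def)

lemma mult_closed: "f \<in> R \<Longrightarrow> g \<in> R \<Longrightarrow> f * g \<in> R"
  using algebra by (auto simp: function_algebra_def)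

lemmas regular_zero = fun_space.subspace_0[OF regular_subspace]
lemmas regular_add = fun_space.subspace_add[OF regular_subspace]
lemmas regular_diff = fun_space.subspace_diff[OF regular_subspace]
lemmas regular_scale = fun_space.subspace_scale[OF regular_subspace]
lemmas regular_sum = fun_space.subspace_sum[OF regular_subspace]

lemmas [intro] =
  unit_regular mult_closed regular_zero regular_add regular_diff regular_scale regular_sum

lemma unit_mult: "f \<in> R \<Longrightarrow> unit_function * f = f"
  by (auto simp: fun_eq_iff indicator_def regular_outside)

lemma mult_unit: "f \<in> R \<Longrightarrow> f * unit_function = f"
  by (auto simp: fun_eq_iff indicator_def regular_outside)

text \<open>The exponent is positive because the zeroth power is the constant 1 on the whole type,
  whereas the unit of \<open>R\<close> is 0 outside the carrier.\<close>

lemma power_closed: "f \<in> R \<Longrightarrow> f ^ Suc n \<in> R"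
  by (induction n) (simp, metis mult_closed power_Suc)

text \<open>The whole linear dual instead of Dist(G): convolution, the action of \<open>R\<close>,
  \<open>Ad\<close> and the Frobenius map all make sense here, so that orders of vanishing can be
  treated separately. The value 0 off \<open>R\<close> makes a functional determined by its
  restriction to \<open>R\<close>.\<close>

definition dual :: "(('g \<Rightarrow> 'k) \<Rightarrow> 'k) set"
  where "dual = {\<mu>. linear_on (*) R \<mu> \<and> (\<forall>f. f \<notin> R \<longrightarrow> \<mu> f = 0)}"

lemma dualI:
  assumes "\<And>f g. f \<in> R \<Longrightarrow> g \<in> R \<Longrightarrow> \<mu> (f + g) = \<mu> f + \<mu> g"
    and "\<And>c f. f \<in> R \<Longrightarrow> \<mu> (fun_scale c f) = c * \<mu> f"
    and "\<And>f. f \<notin> R \<Longrightarrow> \<mu> f = 0"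
  shows "\<mu> \<in> dual"
  using assms by (simp add: dual_def linear_on_def)

lemma dual_add: "\<mu> \<in> dual \<Longrightarrow> f \<in> R \<Longrightarrow> g \<in> R \<Longrightarrow> \<mu> (f + g) = \<mu> f + \<mu> g"
  and dual_scale: "\<mu> \<in> dual \<Longrightarrow> f \<in> R \<Longrightarrow> \<mu> (fun_scale c f) = c * \<mu> f"
  and dual_outside: "\<mu> \<in> dual \<Longrightarrow> f \<notin> R \<Longrightarrow> \<mu> f = 0"
  by (auto simp: dual_def linear_on_def)

lemma dual_zero: "\<mu> \<in> dual \<Longrightarrow> \<mu> 0 = 0"
  using dual_scale[of \<mu> 0 0] regular_zero by (simp add: fun_scale_def flip: zero_fun_def)

lemma dual_diff: "\<mu> \<in> dual \<Longrightarrow> f \<in> R \<Longrightarrow> g \<in> R \<Longrightarrow> \<mu> (f - g) = \<mu> f - \<mu> g"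
  using dual_add[of \<mu> "f - g" g] regular_diff[of f g] by simp

lemma dual_sum:
  assumes "\<mu> \<in> dual" "\<And>i. i \<in> A \<Longrightarrow> f i \<in> R"
  shows "\<mu> (\<Sum>i\<in>A. f i) = (\<Sum>i\<in>A. \<mu> (f i))"
  using assms(2)
proof (induction A rule: infinite_finite_induct)
  case (insert i A)
  then have "\<mu> (f i + sum f A) = \<mu> (f i) + \<mu> (sum f A)"
    by (intro dual_add assms(1) regular_sum) auto
  with insert show ?case
    by (metis insertCI sum.insert)
qed (simp_all add: dual_zero assms)

lemma dual_lincomb:
  assumes "\<mu> \<in> dual" "\<And>i. i \<in> A \<Longrightarrow> f i \<in> R"
  shows "\<mu> (\<Sum>i\<in>A. fun_scale (c i) (f i)) = (\<Sum>i\<in>A. c i * \<mu> (f i))"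
  using assms by (subst dual_sum) (auto simp: dual_scale[OF assms(1)] intro!: regular_scale sum.cong)

lemma dual_eqI:
  assumes "\<mu> \<in> dual" "\<rho> \<in> dual" "\<And>f. f \<in> R \<Longrightarrow> \<mu> f = \<rho> f"
  shows "\<mu> = \<rho>"
proof
  show "\<mu> f = \<rho> f" for f
    using assms by (cases "f \<in> R") (auto simp: dual_outside)
qed

lemma dual_subspace: "fun_space.subspace dual"
  unfolding fun_space.subspace_def
  by (auto intro!: dualI simp: dual_add dual_scale dual_outside algebra_simps)


subsection \<open>The convolution product\<close>

lemma comultE:
  assumes "f \<in> R"
  obtains n :: nat and a b where "\<And>i. i < n \<Longrightarrow> a i \<in> R" "\<And>i. i < n \<Longrightarrow> b i \<in> R"
    "comult G f = (\<Sum>i<n. pure_tensor (a i) (b i))"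
  using mult_regular[OF assms] by (auto simp: tensor_square_def)

text \<open>In a finite sum of pure tensors one variable can be frozen, or fed to a functional, and
  a linear combination of the other factors remains.\<close>

lemma comult_row: "f \<in> R \<Longrightarrow> (\<lambda>y. comult G f (x, y)) \<in> R"
  and comult_column: "f \<in> R \<Longrightarrow> (\<lambda>x. comult G f (x, y)) \<in> R"
  and comult_functional_row: "f \<in> R \<Longrightarrow> \<rho> \<in> dual \<Longrightarrow> (\<lambda>x. \<rho> (\<lambda>y. comult G f (x, y))) \<in> R"
proof -
  assume f: "f \<in> R"
  obtain n :: nat and a b where ab: "\<And>i. i < n \<Longrightarrow> a i \<in> R" "\<And>i. i < n \<Longrightarrow> b i \<in> R"
    and eq: "comult G f = (\<Sum>i<n. pure_tensor (a i) (b i))"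
    by (rule comultE[OF f]) (rule that; simp)
  have row: "(\<lambda>y. comult G f (x, y)) = (\<Sum>i<n. fun_scale (a i x) (b i))" for x
    by (simp add: eq fun_eq_iff sum_fun_apply pure_tensor_def)
  then show "(\<lambda>y. comult G f (x, y)) \<in> R"
    using ab by (auto intro!: regular_sum regular_scale)
  have "(\<lambda>x. comult G f (x, y)) = (\<Sum>i<n. fun_scale (b i y) (a i))"
    by (simp add: eq fun_eq_iff sum_fun_apply pure_tensor_def mult.commute)
  then show "(\<lambda>x. comult G f (x, y)) \<in> R"
    using ab by (auto intro!: regular_sum regular_scale)
  assume \<rho>: "\<rho> \<in> dual"
  have "(\<lambda>x. \<rho> (\<lambda>y. comult G f (x, y))) = (\<Sum>i<n. fun_scale (\<rho> (b i)) (a i))"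
  proof
    fix x
    have "\<rho> (\<Sum>i<n. fun_scale (a i x) (b i)) = (\<Sum>i<n. a i x * \<rho> (b i))"
      using ab(2) by (intro dual_lincomb[OF \<rho>]) simp
    then show "\<rho> (\<lambda>y. comult G f (x, y)) = (\<Sum>i<n. fun_scale (\<rho> (b i)) (a i)) x"
      by (simp add: row sum_fun_apply mult.commute)
  qed
  then show "(\<lambda>x. \<rho> (\<lambda>y. comult G f (x, y))) \<in> R"
    using ab by (auto intro!: regular_sum regular_scale)
qed

lemma tensor_functional_sum:
  assumes "\<mu> \<in> dual" "\<rho> \<in> dual" "\<And>i. i \<in> A \<Longrightarrow> a i \<in> R" "\<And>i. i \<in> A \<Longrightarrow> b i \<in> R"
  shows "tensor_functional \<mu> \<rho> (\<Sum>i\<in>A. pure_tensor (a i) (b i)) = (\<Sum>i\<in>A. \<mu> (a i) * \<rho> (b i))"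
proof -
  have "(\<lambda>y. (\<Sum>i\<in>A. pure_tensor (a i) (b i)) (x, y)) = (\<Sum>i\<in>A. fun_scale (a i x) (b i))" for x
    by (simp add: fun_eq_iff sum_fun_apply pure_tensor_def)
  then have "(\<lambda>x. \<rho> (\<lambda>y. (\<Sum>i\<in>A. pure_tensor (a i) (b i)) (x, y)))
      = (\<lambda>x. \<rho> (\<Sum>i\<in>A. fun_scale (a i x) (b i)))"
    by simp
  also have "\<dots> = (\<Sum>i\<in>A. fun_scale (\<rho> (b i)) (a i))"
    using assms(3,4)
    by (simp add: fun_eq_iff dual_lincomb[OF assms(2)] sum_fun_apply mult.commute)
  finally show ?thesis
    using assms(3,4)
    by (simp add: tensor_functional_def dual_lincomb[OF assms(1)] mult.commute)
qed

text \<open>The iterated form of \<open>tensor_functional\<close> mentions no decomposition of the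
  coproduct, so every decomposition computes the product. Later ones are chosen to fit: conjugated
  factors, or factors raised to the power \<open>q\<close>.\<close>

lemma dist_mult_sum:
  assumes "\<mu> \<in> dual" "\<rho> \<in> dual" "f \<in> R" "\<And>i. i \<in> A \<Longrightarrow> a i \<in> R" "\<And>i. i \<in> A \<Longrightarrow> b i \<in> R"
    and "comult G f = (\<Sum>i\<in>A. pure_tensor (a i) (b i))"
  shows "dist_mult G R \<mu> \<rho> f = (\<Sum>i\<in>A. \<mu> (a i) * \<rho> (b i))"
  using tensor_functional_sum[OF assms(1,2,4,5)] assms(3,6) by (simp add: dist_mult_def)

lemma dist_mult_dual:
  assumes "\<mu> \<in> dual" "\<rho> \<in> dual"
  shows "dist_mult G R \<mu> \<rho> \<in> dual"
proof (rule dualI)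
  fix f g assume fg: "f \<in> R" "g \<in> R"
  have "(\<lambda>y. comult G (f + g) (x, y)) = (\<lambda>y. comult G f (x, y)) + (\<lambda>y. comult G g (x, y))" for x
    by (simp add: comult_def fun_eq_iff)
  then have "(\<lambda>x. \<rho> (\<lambda>y. comult G (f + g) (x, y)))
      = (\<lambda>x. \<rho> (\<lambda>y. comult G f (x, y))) + (\<lambda>x. \<rho> (\<lambda>y. comult G g (x, y)))"
    using fg assms by (simp only: dual_add comult_row) (simp add: plus_fun_def)
  then show "dist_mult G R \<mu> \<rho> (f + g) = dist_mult G R \<mu> \<rho> f + dist_mult G R \<mu> \<rho> g"
    using fg assms
    by (simp add: dist_mult_def tensor_functional_def regular_add dual_add comult_functional_row)
next
  fix f c assume f: "f \<in> R"
  have "(\<lambda>y. comult G (fun_scale c f) (x, y)) = fun_scale c (\<lambda>y. comult G f (x, y))" for x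
    by (simp add: comult_def fun_eq_iff)
  then have "(\<lambda>x. \<rho> (\<lambda>y. comult G (fun_scale c f) (x, y)))
      = fun_scale c (\<lambda>x. \<rho> (\<lambda>y. comult G f (x, y)))"
    using f assms by (simp only: dual_scale comult_row) (simp add: fun_scale_def)
  then show "dist_mult G R \<mu> \<rho> (fun_scale c f) = c * dist_mult G R \<mu> \<rho> f"
    using f assms
    by (simp add: dist_mult_def tensor_functional_def regular_scale dual_scale comult_functional_row)
qed (simp add: dist_mult_def)

lemma dist_mult_zero_left: "dist_mult G R 0 \<rho> = 0"
  by (simp add: dist_mult_def tensor_functional_def fun_eq_iff)

lemma dist_mult_zero_right: "\<mu> \<in> dual \<Longrightarrow> dist_mult G R \<mu> 0 = 0"
  using dual_zero by (simp add: dist_mult_def tensor_functional_def fun_eq_iff zero_fun_def)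

text \<open>The unit function is group-like. Hence products and brackets of functionals that kill
  constants again kill constants.\<close>

lemma dist_mult_unit:
  assumes "\<mu> \<in> dual" "\<rho> \<in> dual"
  shows "dist_mult G R \<mu> \<rho> unit_function = \<mu> unit_function * \<rho> unit_function"
proof -
  have "comult G unit_function = (\<Sum>i<1::nat. pure_tensor unit_function unit_function)"
    by (auto simp: comult_def pure_tensor_def fun_eq_iff indicator_def)
  from dist_mult_sum[OF assms unit_regular _ _ this] show ?thesis
    by (simp add: unit_regular)
qed

text \<open>The dual is a module over \<open>R\<close>; this action drives all inductions on the filtration.\<close>

definition shift :: "('g \<Rightarrow> 'k) \<Rightarrow> (('g \<Rightarrow> 'k) \<Rightarrow> 'k) \<Rightarrow> ('g \<Rightarrow> 'k) \<Rightarrow> 'k"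
  where "shift f \<mu> = (\<lambda>h. if h \<in> R then \<mu> (f * h) else 0)"

lemma shift_dual: "f \<in> R \<Longrightarrow> \<mu> \<in> dual \<Longrightarrow> shift f \<mu> \<in> dual"
proof (rule dualI)
  assume f: "f \<in> R" and \<mu>: "\<mu> \<in> dual"
  show "shift f \<mu> (g + h) = shift f \<mu> g + shift f \<mu> h" if "g \<in> R" "h \<in> R" for g h
    using f \<mu> that by (simp add: shift_def regular_add dual_add mult_closed distrib_left)
  have "f * fun_scale c g = fun_scale c (f * g)" for c g
    by (simp add: fun_eq_iff)
  then show "shift f \<mu> (fun_scale c g) = c * shift f \<mu> g" if "g \<in> R" for c g
    using f \<mu> that by (simp add: shift_def regular_scale dual_scale mult_closed)
qed (simp add: shift_def)

lemma shift_unit: "\<mu> \<in> dual \<Longrightarrow> shift unit_function \<mu> = \<mu>"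
  by (auto simp: shift_def fun_eq_iff unit_mult dual_outside)

lemma shift_mult: "f \<in> R \<Longrightarrow> g \<in> R \<Longrightarrow> shift (f * g) \<mu> = shift g (shift f \<mu>)"
  by (auto simp: shift_def fun_eq_iff mult_closed mult.assoc)

lemma shift_add_left:
  "f \<in> R \<Longrightarrow> g \<in> R \<Longrightarrow> \<mu> \<in> dual \<Longrightarrow> shift (f + g) \<mu> = shift f \<mu> + shift g \<mu>"
  by (auto simp: shift_def fun_eq_iff distrib_right dual_add mult_closed)

lemma shift_scale_left:
  assumes "f \<in> R" "\<mu> \<in> dual"
  shows "shift (fun_scale c f) \<mu> = fun_scale c (shift f \<mu>)"
proof -
  have "fun_scale c f * g = fun_scale c (f * g)" for g
    by (simp add: fun_eq_iff)
  then show ?thesis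
    using assms by (intro ext) (simp add: shift_def dual_scale mult_closed)
qed

lemma comult_mult: "comult G (f * g) = comult G f * comult G g"
  by (auto simp: comult_def fun_eq_iff)

text \<open>Convolution is the transpose of the coproduct, and the coproduct is multiplicative;
  therefore \<open>f\<close> acts on a product of functionals through its coproduct acting on the
  pair of factors.\<close>

lemma shift_dist_mult:
  assumes \<mu>: "\<mu> \<in> dual" and \<rho>: "\<rho> \<in> dual" and f: "f \<in> R" and fin: "finite A"
    and a: "\<And>i. i \<in> A \<Longrightarrow> a i \<in> R" and b: "\<And>i. i \<in> A \<Longrightarrow> b i \<in> R"
    and eq: "comult G f = (\<Sum>i\<in>A. pure_tensor (a i) (b i))"
  shows "shift f (dist_mult G R \<mu> \<rho>) = (\<Sum>i\<in>A. dist_mult G R (shift (a i) \<mu>) (shift (b i) \<rho>))"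
proof
  fix h
  show "shift f (dist_mult G R \<mu> \<rho>) h = (\<Sum>i\<in>A. dist_mult G R (shift (a i) \<mu>) (shift (b i) \<rho>)) h"
  proof (cases "h \<in> R")
    case h: True
    obtain n :: nat and c d where c: "\<And>i. i < n \<Longrightarrow> c i \<in> R" and d: "\<And>i. i < n \<Longrightarrow> d i \<in> R"
      and heq: "comult G h = (\<Sum>i<n. pure_tensor (c i) (d i))"
      by (rule comultE[OF h]) (rule that; simp)
    have "comult G (f * h)
        = (\<Sum>(i, j)\<in>A \<times> {..<n}. pure_tensor (a i * c j) (b i * d j))"
      unfolding comult_mult eq heq sum_product sum.cartesian_product
      by (intro sum.cong refl) (auto simp: pure_tensor_def fun_eq_iff)
    then have "comult G (f * h)
        = (\<Sum>p\<in>A \<times> {..<n}. pure_tensor (a (fst p) * c (snd p)) (b (fst p) * d (snd p)))"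
      by (simp add: case_prod_beta)
    then have "dist_mult G R \<mu> \<rho> (f * h)
        = (\<Sum>p\<in>A \<times> {..<n}. \<mu> (a (fst p) * c (snd p)) * \<rho> (b (fst p) * d (snd p)))"
      using \<mu> \<rho> f h a b c d by (intro dist_mult_sum) (auto intro!: mult_closed)
    also have "\<dots> = (\<Sum>i\<in>A. \<Sum>j<n. \<mu> (a i * c j) * \<rho> (b i * d j))"
      by (simp add: sum.cartesian_product case_prod_beta)
    also have "\<dots> = (\<Sum>i\<in>A. dist_mult G R (shift (a i) \<mu>) (shift (b i) \<rho>) h)"
    proof (rule sum.cong[OF refl])
      fix i assume i: "i \<in> A"
      have "dist_mult G R (shift (a i) \<mu>) (shift (b i) \<rho>) h
          = (\<Sum>j<n. shift (a i) \<mu> (c j) * shift (b i) \<rho> (d j))"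
        using i \<mu> \<rho> h a b c d heq by (intro dist_mult_sum shift_dual) auto
      then show "(\<Sum>j<n. \<mu> (a i * c j) * \<rho> (b i * d j))
          = dist_mult G R (shift (a i) \<mu>) (shift (b i) \<rho>) h"
        using c d by (simp add: shift_def)
    qed
    finally show ?thesis
      using h by (simp add: shift_def sum_fun_apply)
  qed (simp add: shift_def sum_fun_apply dist_mult_def)
qed

section \<open>The augmentation ideal under the coproduct\<close>

abbreviation aug :: "('g \<Rightarrow> 'k) set"
  where "aug \<equiv> augmentation_ideal G R"

lemma augD: "f \<in> aug \<Longrightarrow> f \<in> R" "f \<in> aug \<Longrightarrow> f \<one> = 0"
  by (auto simp: augmentation_ideal_def)

lemma augI: "f \<in> R \<Longrightarrow> f \<one> = 0 \<Longrightarrow> f \<in> aug"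
  by (auto simp: augmentation_ideal_def)

lemma aug_mult: "f \<in> aug \<Longrightarrow> h \<in> R \<Longrightarrow> f * h \<in> aug"
  by (auto simp: augmentation_ideal_def)

lemma aug_proj: "f \<in> R \<Longrightarrow> f - fun_scale (f \<one>) unit_function \<in> aug"
  by (auto simp: augmentation_ideal_def)

text \<open>The \<open>i\<close>-th summand below is \<open>(a i - a i 1) \<otimes> (b i - b i 1)\<close> for \<open>\<Delta> f = \<Sum> a i \<otimes> b i\<close>.\<close>

lemma comult_augE:
  assumes f: "f \<in> aug"
  obtains n :: nat and a b where "\<And>i. i < n \<Longrightarrow> a i \<in> aug" "\<And>i. i < n \<Longrightarrow> b i \<in> aug"
    "comult G f = pure_tensor f unit_function + pure_tensor unit_function f
       + (\<Sum>i<n. pure_tensor (a i) (b i))"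
proof -
  obtain n :: nat and a b where ab: "\<And>i. i < n \<Longrightarrow> a i \<in> R" "\<And>i. i < n \<Longrightarrow> b i \<in> R"
    and eq: "comult G f = (\<Sum>i<n. pure_tensor (a i) (b i))"
    by (rule comultE[OF augD(1)[OF f]]) (rule that; simp)
  have eq': "f (x \<otimes> y) = (\<Sum>i<n. a i x * b i y)" if "x \<in> carrier G" "y \<in> carrier G" for x y
    using fun_cong[OF eq, of "(x, y)"] that by (simp add: comult_def sum_fun_apply pure_tensor_def)
  define a' where "a' i = a i - fun_scale (a i \<one>) unit_function" for i
  define b' where "b' i = b i - fun_scale (b i \<one>) unit_function" for i
  have "(\<Sum>i<n. pure_tensor (a' i) (b' i)) (x, y)
      = comult G f (x, y) - pure_tensor f unit_function (x, y) - pure_tensor unit_function f (x, y)"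
    for x y
  proof (cases "x \<in> carrier G \<and> y \<in> carrier G")
    case True
    \<comment> \<open>The counit identities, obtained by putting \<open>\<one>\<close> for one
      variable or for both; the last one uses \<open>f \<one> = 0\<close>. They evaluate the cross
      terms that arise when the constants are subtracted from \<open>a i\<close> and
      \<open>b i\<close>.\<close>
    then have "f x = (\<Sum>i<n. a i x * b i \<one>)" "f y = (\<Sum>i<n. a i \<one> * b i y)"
      "0 = (\<Sum>i<n. a i \<one> * b i \<one>)"
      using eq'[of x \<one>] eq'[of \<one> y] eq'[of \<one> \<one>] augD(2)[OF f] by auto
    with True show ?thesis
      by (simp add: a'_def b'_def sum_fun_apply pure_tensor_def comult_def eq' left_diff_distrib
          right_diff_distrib sum_subtractf sum.distrib)
  next
    case False
    then have "pure_tensor (a' i) (b' i) (x, y) = 0" if "i < n" for i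
      using ab that by (auto simp: pure_tensor_def a'_def b'_def regular_outside)
    then have "(\<Sum>i<n. pure_tensor (a' i) (b' i)) (x, y) = 0"
      by (simp add: sum_fun_apply)
    with False show ?thesis
      using augD(1)[OF f] by (auto simp: pure_tensor_def comult_def regular_outside)
  qed
  then have "comult G f = pure_tensor f unit_function + pure_tensor unit_function f
       + (\<Sum>i<n. pure_tensor (a' i) (b' i))"
    by (auto simp: fun_eq_iff)
  with that[of n a' b'] show ?thesis
    using ab by (simp add: a'_def b'_def aug_proj)
qed

text \<open>In the two outer terms one factor stays untouched; in all others both factors are hit by
  the augmentation ideal. The same \<open>a\<close> and \<open>b\<close> serve all functionals,
  because a bracket needs the formula for both orders of its arguments.\<close>

lemma shift_dist_mult_augE:
  assumes f: "f \<in> aug"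
  obtains n :: nat and a b where "\<And>i. i < n \<Longrightarrow> a i \<in> aug" "\<And>i. i < n \<Longrightarrow> b i \<in> aug"
    "\<And>\<mu> \<rho>. \<mu> \<in> dual \<Longrightarrow> \<rho> \<in> dual \<Longrightarrow>
       shift f (dist_mult G R \<mu> \<rho>) = dist_mult G R (shift f \<mu>) \<rho> + dist_mult G R \<mu> (shift f \<rho>)
         + (\<Sum>i<n. dist_mult G R (shift (a i) \<mu>) (shift (b i) \<rho>))"
proof -
  obtain n :: nat and a b where a: "\<And>i. i < n \<Longrightarrow> a i \<in> aug" and b: "\<And>i. i < n \<Longrightarrow> b i \<in> aug"
    and eq: "comult G f = pure_tensor f unit_function + pure_tensor unit_function f
       + (\<Sum>i<n. pure_tensor (a i) (b i))"
    by (rule comult_augE[OF f]) (rule that; simp)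
  \<comment> \<open>Positions \<open>n\<close> and \<open>n + 1\<close> hold the two outer tensors,
    so that \<open>shift_dist_mult\<close> sees a single indexed family.\<close>
  define a' where "a' i = (if i < n then a i else if i = n then f else unit_function)" for i
  define b' where "b' i = (if i < n then b i else if i = n then unit_function else f)" for i
  have eq': "comult G f = (\<Sum>i<Suc (Suc n). pure_tensor (a' i) (b' i))"
    by (simp add: eq a'_def b'_def add_ac)
  have mem: "a' i \<in> R" "b' i \<in> R" for i
    using a b f by (auto simp: a'_def b'_def augD)
  have "shift f (dist_mult G R \<mu> \<rho>) = dist_mult G R (shift f \<mu>) \<rho> + dist_mult G R \<mu> (shift f \<rho>)
         + (\<Sum>i<n. dist_mult G R (shift (a i) \<mu>) (shift (b i) \<rho>))"
    if "\<mu> \<in> dual" "\<rho> \<in> dual" for \<mu> \<rho>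
    unfolding shift_dist_mult[OF that augD(1)[OF f] finite_lessThan mem eq']
    by (simp add: a'_def b'_def that shift_unit add_ac)
  with that a b show ?thesis
    by blast
qed


subsection \<open>The filtration\<close>

text \<open>The annihilator of the \<open>n\<close>-th power of the augmentation ideal, indexed by
  the exponent, so that Dist_k has index \<open>k + 1\<close>. The multiplier \<open>h\<close> makes
  the products generate an ideal and gives index 0 its proper meaning, the annihilator of all of
  \<open>R\<close>, where the inductions start.\<close>

definition vanishing :: "nat \<Rightarrow> (('g \<Rightarrow> 'k) \<Rightarrow> 'k) set"
  where "vanishing n =
     {\<mu> \<in> dual. \<forall>F. (\<forall>i<n. F i \<in> aug) \<longrightarrow> (\<forall>h\<in>R. \<mu> ((\<Prod>i<n. F i) * h) = 0)}"

lemma vanishing_dual: "\<mu> \<in> vanishing n \<Longrightarrow> \<mu> \<in> dual"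
  by (simp add: vanishing_def)

lemma prod_mult_regular:
  fixes n :: nat
  shows "(\<And>i. i < n \<Longrightarrow> F i \<in> R) \<Longrightarrow> h \<in> R \<Longrightarrow> (\<Prod>i<n. F i) * h \<in> R"
  by (induction n arbitrary: h) (auto simp: mult.assoc mult_closed)

lemma vanishing_subspace: "fun_space.subspace (vanishing n)"
  unfolding fun_space.subspace_def
  using fun_space.subspace_0[OF dual_subspace] fun_space.subspace_add[OF dual_subspace]
    fun_space.subspace_scale[OF dual_subspace]
  by (auto simp: vanishing_def)

lemma vanishing_0: "vanishing 0 = {0}"
proof -
  have "\<mu> = 0" if "\<mu> \<in> vanishing 0" for \<mu>
    using that by (intro dual_eqI) (auto simp: vanishing_def fun_space.subspace_0[OF dual_subspace])
  then show ?thesis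
    using fun_space.subspace_0[OF vanishing_subspace] by auto
qed

text \<open>One factor of the product is moved from the argument into the functional. This recursion
  is what the inductions on the filtration run on.\<close>

lemma vanishing_Suc: "\<mu> \<in> vanishing (Suc n) \<longleftrightarrow> \<mu> \<in> dual \<and> (\<forall>f\<in>aug. shift f \<mu> \<in> vanishing n)"
proof safe
  assume \<mu>: "\<mu> \<in> vanishing (Suc n)"
  then show "\<mu> \<in> dual"
    by (rule vanishing_dual)
  fix f assume f: "f \<in> aug"
  have "shift f \<mu> ((\<Prod>i<n. F i) * h) = 0" if F: "\<forall>i<n. F i \<in> aug" and h: "h \<in> R" for F h
  proof -
    define F' where "F' i = (if i < n then F i else f)" for i
    have "\<mu> ((\<Prod>i<Suc n. F' i) * h) = 0"
      using \<mu> F f h unfolding vanishing_def by (auto simp: F'_def simp del: prod.lessThan_Suc)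
    moreover have "(\<Prod>i<Suc n. F' i) * h = f * ((\<Prod>i<n. F i) * h)"
      by (simp add: F'_def mult_ac)
    moreover have "(\<Prod>i<n. F i) * h \<in> R"
      using F h by (auto intro!: prod_mult_regular dest: augD)
    ultimately show ?thesis
      by (simp add: shift_def)
  qed
  then show "shift f \<mu> \<in> vanishing n"
    using vanishing_dual[OF \<mu>] augD(1)[OF f] by (simp add: vanishing_def shift_dual)
next
  assume \<mu>: "\<mu> \<in> dual" and sh: "\<forall>f\<in>aug. shift f \<mu> \<in> vanishing n"
  have "\<mu> ((\<Prod>i<Suc n. F i) * h) = 0" if F: "\<forall>i<Suc n. F i \<in> aug" and h: "h \<in> R" for F h
  proof -
    have "shift (F n) \<mu> ((\<Prod>i<n. F i) * h) = 0"
      using sh F h unfolding vanishing_def by auto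
    moreover have "(\<Prod>i<n. F i) * h \<in> R"
      using F h by (intro prod_mult_regular) (simp_all add: augD)
    ultimately show ?thesis
      by (simp add: shift_def mult_ac)
  qed
  with \<mu> show "\<mu> \<in> vanishing (Suc n)"
    by (simp add: vanishing_def)
qed

lemma vanishing_mono:
  assumes "m \<le> n"
  shows "vanishing m \<subseteq> vanishing n"
proof -
  have "vanishing n \<subseteq> vanishing (Suc n)" for n
  proof (induction n)
    case 0
    then show ?case
      using fun_space.subspace_0[OF vanishing_subspace] by (simp add: vanishing_0)
  next
    case (Suc n)
    then show ?case
      unfolding vanishing_Suc[of _ n] vanishing_Suc[of _ "Suc n"] subset_iff by blast
  qed
  then show ?thesis
    using lift_Suc_mono_le[of vanishing] assms by blast
qed

text \<open>With at least one factor, a multiplier \<open>h\<close> can be absorbed into the last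
  factor; conversely the unit function is an admissible multiplier.\<close>

lemma Dist_filt_eq: "Dist_filt G R k = vanishing (Suc k)"
proof (rule Set.set_eqI)
  fix \<mu>
  let ?P = "{\<Prod>i<Suc k. F i | F. \<forall>i<Suc k. F i \<in> aug}"
  have P: "?P \<subseteq> R"
  proof safe
    fix F :: "nat \<Rightarrow> 'g \<Rightarrow> 'k" assume F: "\<forall>i<Suc k. F i \<in> aug"
    then have "(\<Prod>i<k. F i) * F k \<in> R"
      by (intro prod_mult_regular) (simp_all add: augD)
    then show "(\<Prod>i<Suc k. F i) \<in> R"
      by (simp add: mult.commute)
  qed
  have "\<mu> \<in> Dist_filt G R k \<longleftrightarrow> \<mu> \<in> dual \<and> (\<forall>f\<in>fun_space.span ?P. \<mu> f = 0)"
    by (simp add: Dist_filt_def dual_def ideal_power_def del: prod.lessThan_Suc)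
  also have "\<dots> \<longleftrightarrow> \<mu> \<in> dual \<and> (\<forall>f\<in>?P. \<mu> f = 0)"
  proof (intro conj_cong refl iffI ballI)
    fix f assume "\<forall>f\<in>fun_space.span ?P. \<mu> f = 0" "f \<in> ?P"
    then show "\<mu> f = 0"
      using fun_space.span_base[of f ?P] by blast
  next
    fix f assume \<mu>: "\<mu> \<in> dual" and zero: "\<forall>f\<in>?P. \<mu> f = 0" and f: "f \<in> fun_space.span ?P"
    have "f \<in> R \<and> \<mu> f = 0"
      using f
    proof (induction rule: fun_space.span_induct_alt)
      case base
      show ?case
        by (simp add: dual_zero[OF \<mu>] regular_zero flip: zero_fun_def)
    next
      case (step c x y)
      then have "x \<in> R" "\<mu> x = 0"
        using P zero by blast+
      with step have "fun_scale c x + y \<in> R \<and> \<mu> (fun_scale c x + y) = 0"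
        by (simp add: dual_add[OF \<mu>] dual_scale[OF \<mu>] regular_scale regular_add)
      then show ?case .
    qed
    then show "\<mu> f = 0" ..
  qed
  also have "\<dots> \<longleftrightarrow> \<mu> \<in> vanishing (Suc k)"
  proof safe
    assume \<mu>: "\<mu> \<in> dual" and zero: "\<forall>f\<in>?P. \<mu> f = 0"
    have "\<mu> ((\<Prod>i<Suc k. F i) * h) = 0" if F: "\<forall>i<Suc k. F i \<in> aug" and h: "h \<in> R" for F h
    proof -
      define F' where "F' i = (if i < k then F i else F i * h)" for i
      have "(\<Prod>i<Suc k. F i) * h = (\<Prod>i<Suc k. F' i)"
        by (simp add: F'_def mult_ac)
      moreover have "\<forall>i<Suc k. F' i \<in> aug"
        using F h by (simp add: F'_def aug_mult)
      ultimately show ?thesis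
        using zero by blast
    qed
    with \<mu> show "\<mu> \<in> vanishing (Suc k)"
      by (simp add: vanishing_def)
  next
    fix F :: "nat \<Rightarrow> 'g \<Rightarrow> 'k"
    assume \<mu>: "\<mu> \<in> vanishing (Suc k)" and F: "\<forall>i<Suc k. F i \<in> aug"
    then have "\<mu> ((\<Prod>i<Suc k. F i) * unit_function) = 0"
      using unit_regular unfolding vanishing_def by blast
    moreover have "(\<Prod>i<Suc k. F i) \<in> R"
      using P F by blast
    ultimately show "\<mu> (\<Prod>i<Suc k. F i) = 0"
      by (simp add: mult_unit del: prod.lessThan_Suc)
  qed (rule vanishing_dual)
  finally show "\<mu> \<in> Dist_filt G R k \<longleftrightarrow> \<mu> \<in> vanishing (Suc k)" .
qed

text \<open>In terms of degrees \<open>i = m - 1\<close> and \<open>j = n - 1\<close> the bound is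
  \<open>i + j\<close>. Acting by an element of the augmentation ideal lowers \<open>m + n\<close>
  by one in the two outer terms and by two in the others, so \<open>vanishing_Suc\<close> gives an
  induction on \<open>m + n\<close>. Truncated subtraction does no harm, since index 0 contains only
  the zero functional.\<close>

lemma dist_mult_vanishing:
  "\<mu> \<in> vanishing m \<Longrightarrow> \<rho> \<in> vanishing n \<Longrightarrow> dist_mult G R \<mu> \<rho> \<in> vanishing (m + n - 1)"
proof (induction "m + n" arbitrary: m n \<mu> \<rho> rule: less_induct)
  case less
  note \<mu> = vanishing_dual[OF less.prems(1)] and \<rho> = vanishing_dual[OF less.prems(2)]
  consider "m = 0" | "n = 0" | m' n' where "m = Suc m'" "n = Suc n'"
    by (metis not0_implies_Suc)
  then show ?case
  proof cases
    case 1
    then show ?thesis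
      using less.prems fun_space.subspace_0[OF vanishing_subspace]
      by (simp add: vanishing_0 dist_mult_zero_left)
  next
    case 2
    then show ?thesis
      using less.prems fun_space.subspace_0[OF vanishing_subspace]
      by (simp add: vanishing_0 dist_mult_zero_right[OF \<mu>])
  next
    case 3
    have sh\<mu>: "shift f \<mu> \<in> vanishing m'" and sh\<rho>: "shift f \<rho> \<in> vanishing n'" if "f \<in> aug" for f
      using less.prems that 3 by (auto simp: vanishing_Suc)
    have "shift f (dist_mult G R \<mu> \<rho>) \<in> vanishing (m' + n')" if f: "f \<in> aug" for f
    proof -
      obtain l :: nat and a b where ab: "\<And>i. i < l \<Longrightarrow> a i \<in> aug" "\<And>i. i < l \<Longrightarrow> b i \<in> aug"
        and eq: "\<And>\<mu> \<rho>. \<mu> \<in> dual \<Longrightarrow> \<rho> \<in> dual \<Longrightarrow>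
       shift f (dist_mult G R \<mu> \<rho>) = dist_mult G R (shift f \<mu>) \<rho> + dist_mult G R \<mu> (shift f \<rho>)
         + (\<Sum>i<l. dist_mult G R (shift (a i) \<mu>) (shift (b i) \<rho>))"
        by (rule shift_dist_mult_augE[OF f]) (rule that; simp)
      have "dist_mult G R (shift f \<mu>) \<rho> \<in> vanishing (m' + n')"
        using less.hyps[OF _ sh\<mu>[OF f] less.prems(2)] 3 by simp
      moreover have "dist_mult G R \<mu> (shift f \<rho>) \<in> vanishing (m' + n')"
        using less.hyps[OF _ less.prems(1) sh\<rho>[OF f]] 3 by simp
      moreover have "dist_mult G R (shift (a i) \<mu>) (shift (b i) \<rho>) \<in> vanishing (m' + n')"
        if "i < l" for i
        using less.hyps[OF _ sh\<mu> sh\<rho>, of "a i" "b i"] 3 ab[OF that]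
          vanishing_mono[of "m' + n' - 1" "m' + n'"] by auto
      ultimately show ?thesis
        unfolding eq[OF \<mu> \<rho>]
        by (intro fun_space.subspace_add[OF vanishing_subspace]
            fun_space.subspace_sum[OF vanishing_subspace]) auto
    qed
    then show ?thesis
      using dist_mult_dual[OF \<mu> \<rho>] 3 by (simp add: vanishing_Suc)
  qed
qed

text \<open>Dist_0 is the line spanned by evaluation at the identity: \<open>f\<close> is the
  constant \<open>f \<one>\<close> plus an element of the augmentation ideal, and the latter is
  killed.\<close>

lemma vanishing_1_eval:
  assumes "\<mu> \<in> vanishing (Suc 0)" "f \<in> R"
  shows "\<mu> f = f \<one> * \<mu> unit_function"
proof -
  note \<mu> = vanishing_dual[OF assms(1)]
  let ?g = "f - fun_scale (f \<one>) unit_function"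
  have "shift ?g \<mu> = 0"
    using assms aug_proj[OF assms(2)] by (simp add: vanishing_Suc vanishing_0)
  then have "\<mu> (?g * unit_function) = 0"
    using unit_regular by (metis shift_def zero_fun_apply)
  moreover have "?g \<in> R"
    using aug_proj[OF assms(2)] augD by blast
  ultimately have "\<mu> ?g = 0"
    by (simp add: mult_unit)
  then show ?thesis
    using assms(2) by (simp add: dual_diff[OF \<mu>] dual_scale[OF \<mu>] unit_regular regular_scale)
qed

text \<open>
  The associated graded algebra is commutative: modulo the middle terms, which lie two steps
  lower, \<open>shift f\<close> is a derivation of the convolution product.
\<close>

lemma dist_bracket_vanishing:
  "\<mu> \<in> vanishing m \<Longrightarrow> \<rho> \<in> vanishing n \<Longrightarrow> dist_bracket G R \<mu> \<rho> \<in> vanishing (m + n - 2)"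
proof (induction "m + n" arbitrary: m n \<mu> \<rho> rule: less_induct)
  case less
  note \<mu> = vanishing_dual[OF less.prems(1)] and \<rho> = vanishing_dual[OF less.prems(2)]
  consider "m = 0 \<or> n = 0" | "m = 1" "n = 1" | m' n' k where "m = Suc m'" "n = Suc n'" "m' + n' = Suc k"
    by (metis One_nat_def add_is_0 not0_implies_Suc)
  then show ?case
  proof cases
    case 1
    then show ?thesis
      using less.prems fun_space.subspace_0[OF vanishing_subspace]
      by (auto simp: vanishing_0 dist_bracket_def dist_mult_zero_left dist_mult_zero_right \<mu> \<rho>)
  next
    case 2
    \<comment> \<open>Here \<open>m + n - 2\<close> is 0, so the bracket has to vanish outright and
      the recursion says nothing. Both functionals are multiples of evaluation at
      \<open>\<one>\<close>, hence commute.\<close>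
    have "dist_mult G R \<mu> \<rho> f = dist_mult G R \<rho> \<mu> f" for f
    proof (cases "f \<in> R")
      case True
      obtain l :: nat and a b where ab: "\<And>i. i < l \<Longrightarrow> a i \<in> R" "\<And>i. i < l \<Longrightarrow> b i \<in> R"
        and eq: "comult G f = (\<Sum>i<l. pure_tensor (a i) (b i))"
        by (rule comultE[OF True]) (rule that; simp)
      have "dist_mult G R \<mu> \<rho> f = (\<Sum>i<l. \<mu> (a i) * \<rho> (b i))"
        "dist_mult G R \<rho> \<mu> f = (\<Sum>i<l. \<rho> (a i) * \<mu> (b i))"
        using ab by (intro dist_mult_sum[OF _ _ True _ _ eq] \<mu> \<rho>; simp)+
      moreover have "\<mu> h = h \<one> * \<mu> unit_function" "\<rho> h = h \<one> * \<rho> unit_function" if "h \<in> R" for h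
        using vanishing_1_eval[OF _ that] less.prems 2 by simp_all
      ultimately show ?thesis
        using ab by (auto intro!: sum.cong simp: mult_ac)
    qed (simp add: dist_mult_def)
    then have "dist_bracket G R \<mu> \<rho> = 0"
      by (simp add: dist_bracket_def fun_eq_iff)
    then show ?thesis
      using fun_space.subspace_0[OF vanishing_subspace] by simp
  next
    case 3
    have sh\<mu>: "shift f \<mu> \<in> vanishing m'" and sh\<rho>: "shift f \<rho> \<in> vanishing n'" if "f \<in> aug" for f
      using less.prems that 3 by (auto simp: vanishing_Suc)
    have "shift f (dist_bracket G R \<mu> \<rho>) \<in> vanishing k" if f: "f \<in> aug" for f
    proof -
      obtain l :: nat and a b where ab: "\<And>i. i < l \<Longrightarrow> a i \<in> aug" "\<And>i. i < l \<Longrightarrow> b i \<in> aug"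
        and eq: "\<And>\<mu> \<rho>. \<mu> \<in> dual \<Longrightarrow> \<rho> \<in> dual \<Longrightarrow>
       shift f (dist_mult G R \<mu> \<rho>) = dist_mult G R (shift f \<mu>) \<rho> + dist_mult G R \<mu> (shift f \<rho>)
         + (\<Sum>i<l. dist_mult G R (shift (a i) \<mu>) (shift (b i) \<rho>))"
        by (rule shift_dist_mult_augE[OF f]) (rule that; simp)
      have "shift f (dist_bracket G R \<mu> \<rho>)
          = shift f (dist_mult G R \<mu> \<rho>) - shift f (dist_mult G R \<rho> \<mu>)"
        by (auto simp: shift_def dist_bracket_def fun_eq_iff)
      also have "\<dots> = dist_bracket G R (shift f \<mu>) \<rho> + dist_bracket G R \<mu> (shift f \<rho>)
        + ((\<Sum>i<l. dist_mult G R (shift (a i) \<mu>) (shift (b i) \<rho>))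
        - (\<Sum>i<l. dist_mult G R (shift (a i) \<rho>) (shift (b i) \<mu>)))"
        unfolding eq[OF \<mu> \<rho>] eq[OF \<rho> \<mu>] dist_bracket_def by (simp add: algebra_simps)
      finally have eq': "shift f (dist_bracket G R \<mu> \<rho>) = \<dots>" .
      have "dist_bracket G R (shift f \<mu>) \<rho> \<in> vanishing k"
        using less.hyps[OF _ sh\<mu>[OF f] less.prems(2)] 3 by simp
      moreover have "dist_bracket G R \<mu> (shift f \<rho>) \<in> vanishing k"
        using less.hyps[OF _ less.prems(1) sh\<rho>[OF f]] 3 by simp
      \<comment> \<open>With both factors shifted, the bound \<open>m' + n' - 1 = k\<close> for
        plain products already suffices, so these terms need not be paired into brackets.\<close>
      moreover have "dist_mult G R (shift (a i) \<mu>) (shift (b i) \<rho>) \<in> vanishing k"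
        "dist_mult G R (shift (a i) \<rho>) (shift (b i) \<mu>) \<in> vanishing k" if "i < l" for i
        using dist_mult_vanishing[OF sh\<mu> sh\<rho>, of "a i" "b i"]
          dist_mult_vanishing[OF sh\<rho> sh\<mu>, of "a i" "b i"] 3 ab[OF that]
        by (simp_all add: add.commute)
      ultimately show ?thesis
        unfolding eq'
        by (intro fun_space.subspace_add[OF vanishing_subspace]
            fun_space.subspace_diff[OF vanishing_subspace]
            fun_space.subspace_sum[OF vanishing_subspace]) auto
    qed
    moreover have "dist_bracket G R \<mu> \<rho> \<in> dual"
      unfolding dist_bracket_def
      by (intro fun_space.subspace_diff[OF dual_subspace] dist_mult_dual \<mu> \<rho>)
    ultimately have "dist_bracket G R \<mu> \<rho> \<in> vanishing (Suc k)"
      by (simp add: vanishing_Suc)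
    with 3 show ?thesis
      by simp
  qed
qed

section \<open>Distributions that kill the constants\<close>

lemma Dist_plus_iff: "\<mu> \<in> Dist_plus G R k \<longleftrightarrow> \<mu> \<in> vanishing (Suc k) \<and> \<mu> unit_function = 0"
  by (simp add: Dist_plus_def Dist_filt_eq)

lemma Dist_plus_dual: "\<mu> \<in> Dist_plus G R k \<Longrightarrow> \<mu> \<in> dual"
  using vanishing_dual by (auto simp: Dist_plus_iff)

lemma Dist_plus_mono: "i \<le> j \<Longrightarrow> Dist_plus G R i \<subseteq> Dist_plus G R j"
  using vanishing_mono[of "Suc i" "Suc j"] by (auto simp: Dist_plus_iff)

lemma Dist_plus_subspace: "fun_space.subspace (Dist_plus G R k)"
  unfolding fun_space.subspace_def
  by (auto simp: Dist_plus_iff fun_space.subspace_0[OF vanishing_subspace]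
      fun_space.subspace_add[OF vanishing_subspace] fun_space.subspace_scale[OF vanishing_subspace])

lemma dist_mult_Dist_plus:
  assumes "\<mu> \<in> Dist_plus G R i" "\<rho> \<in> Dist_plus G R j"
  shows "dist_mult G R \<mu> \<rho> \<in> Dist_plus G R (i + j)"
  using dist_mult_vanishing[of \<mu> "Suc i" \<rho> "Suc j"] assms
    dist_mult_unit[OF assms[THEN Dist_plus_dual]]
  by (simp add: Dist_plus_iff)

text \<open>The indices \<open>Suc i\<close> and \<open>Suc j\<close> combine to
  \<open>Suc i + Suc j - 2 = i + j\<close>, which is degree \<open>i + j - 1\<close>, one less than
  for a product; hence the room for \<open>i + j = Suc k\<close>.\<close>

lemma dist_bracket_Dist_plus:
  assumes "\<mu> \<in> Dist_plus G R i" "\<rho> \<in> Dist_plus G R j" "i + j \<le> Suc k"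
  shows "dist_bracket G R \<mu> \<rho> \<in> Dist_plus G R k"
proof -
  have "dist_bracket G R \<mu> \<rho> \<in> vanishing (Suc i + Suc j - 2)"
    using assms by (intro dist_bracket_vanishing) (auto simp: Dist_plus_iff)
  then have "dist_bracket G R \<mu> \<rho> \<in> vanishing (Suc k)"
    using vanishing_mono[of "Suc i + Suc j - 2" "Suc k"] assms(3) by auto
  then show ?thesis
    using assms dist_mult_unit[OF assms(1,2)[THEN Dist_plus_dual]]
      dist_mult_unit[OF assms(2,1)[THEN Dist_plus_dual]]
    by (simp add: Dist_plus_iff dist_bracket_def)
qed


section \<open>The adjoint action\<close>

abbreviation conj_fun :: "'g \<Rightarrow> ('g \<Rightarrow> 'k) \<Rightarrow> 'g \<Rightarrow> 'k"
  where "conj_fun g \<equiv> pull G (\<lambda>x. g \<otimes> x \<otimes> inv g)"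

text \<open>Freezing a variable of the coproduct twice gives translation by \<open>g\<close> on the
  left and by its inverse on the right.\<close>

lemma conj_fun_regular:
  assumes "g \<in> carrier G" "f \<in> R"
  shows "conj_fun g f \<in> R"
proof -
  let ?f = "\<lambda>y. comult G f (g, y)"
  have "(\<lambda>x. comult G ?f (x, inv g)) \<in> R"
    using assms by (intro comult_column comult_row)
  moreover have "(\<lambda>x. comult G ?f (x, inv g)) = conj_fun g f"
    using assms by (auto simp: comult_def pull_def m_assoc)
  ultimately show ?thesis
    by simp
qed

lemma conj_fun_add: "conj_fun g (f + f') = conj_fun g f + conj_fun g f'"
  and conj_fun_scale: "conj_fun g (fun_scale c f) = fun_scale c (conj_fun g f)"
  and conj_fun_mult: "conj_fun g (f * f') = conj_fun g f * conj_fun g f'"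
  by (auto simp: pull_def)

lemma conj_fun_unit: "g \<in> carrier G \<Longrightarrow> conj_fun g unit_function = unit_function"
  by (auto simp: pull_def indicator_def)

lemma conj_fun_aug: "g \<in> carrier G \<Longrightarrow> f \<in> aug \<Longrightarrow> conj_fun g f \<in> aug"
  using conj_fun_regular augD[of f] by (intro augI) (auto simp: pull_def)

lemma conj_fun_prod_mult:
  fixes n :: nat
  shows "conj_fun g ((\<Prod>i<n. F i) * h) = (\<Prod>i<n. conj_fun g (F i)) * conj_fun g h"
proof (induction n arbitrary: h)
  case (Suc n)
  have "conj_fun g ((\<Prod>i<Suc n. F i) * h) = conj_fun g ((\<Prod>i<n. F i) * (F n * h))"
    by (simp add: mult.assoc)
  also have "\<dots> = (\<Prod>i<Suc n. conj_fun g (F i)) * conj_fun g h"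
    unfolding Suc.IH by (simp add: conj_fun_mult mult.assoc)
  finally show ?case .
qed simp

lemma comult_conj_fun:
  assumes "g \<in> carrier G" "comult G f = (\<Sum>i\<in>A. pure_tensor (a i) (b i))"
  shows "comult G (conj_fun g f) = (\<Sum>i\<in>A. pure_tensor (conj_fun g (a i)) (conj_fun g (b i)))"
proof
  fix p :: "'g \<times> 'g"
  obtain x y where p: "p = (x, y)"
    by fastforce
  show "comult G (conj_fun g f) p = (\<Sum>i\<in>A. pure_tensor (conj_fun g (a i)) (conj_fun g (b i))) p"
  proof (cases "x \<in> carrier G \<and> y \<in> carrier G")
    case True
    have "g \<otimes> (x \<otimes> y) \<otimes> inv g = (g \<otimes> x \<otimes> inv g) \<otimes> (g \<otimes> y \<otimes> inv g)"
      using True assms(1) by (simp add: m_assoc inv_solve_left)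
    then have "comult G (conj_fun g f) p = comult G f (g \<otimes> x \<otimes> inv g, g \<otimes> y \<otimes> inv g)"
      using True assms(1) by (simp add: p comult_def pull_def)
    with True show ?thesis
      by (simp add: p assms(2) sum_fun_apply pure_tensor_def pull_def)
  next
    case False
    then show ?thesis
      by (auto simp: p sum_fun_apply pure_tensor_def pull_def comult_def)
  qed
qed

lemma Ad_linear: "linear_on fun_scale dual (Ad G R g)"
  by (auto simp: linear_on_def Ad_def fun_eq_iff)

lemma Ad_apply: "f \<in> R \<Longrightarrow> Ad G R g \<mu> f = \<mu> (conj_fun g f)"
  by (simp add: Ad_def)

lemma Ad_dual:
  assumes "g \<in> carrier G" "\<mu> \<in> dual"
  shows "Ad G R g \<mu> \<in> dual"
  using assms
  by (intro dualI)
    (simp_all add: Ad_def regular_add regular_scale conj_fun_add conj_fun_scale conj_fun_regular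
      dual_add[OF assms(2)] dual_scale[OF assms(2)])

text \<open>Conjugation fixes the identity, so its comorphism maps the augmentation ideal into
  itself and respects products of its elements.\<close>

lemma Ad_Dist_plus:
  assumes g: "g \<in> carrier G" and \<mu>: "\<mu> \<in> Dist_plus G R k"
  shows "Ad G R g \<mu> \<in> Dist_plus G R k"
proof -
  have "Ad G R g \<mu> ((\<Prod>i<Suc k. F i) * h) = 0" if F: "\<forall>i<Suc k. F i \<in> aug" and h: "h \<in> R" for F h
  proof -
    have "Ad G R g \<mu> ((\<Prod>i<Suc k. F i) * h) = \<mu> ((\<Prod>i<Suc k. conj_fun g (F i)) * conj_fun g h)"
      using F h by (subst Ad_apply) (auto intro: prod_mult_regular dest: augD simp: conj_fun_prod_mult
        simp del: prod.lessThan_Suc)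
    moreover have "\<forall>i<Suc k. conj_fun g (F i) \<in> aug" "conj_fun g h \<in> R"
      using F h g by (simp_all add: conj_fun_aug conj_fun_regular)
    ultimately show ?thesis
      using \<mu> by (simp add: Dist_plus_iff vanishing_def del: prod.lessThan_Suc)
  qed
  then have "Ad G R g \<mu> \<in> vanishing (Suc k)"
    using Ad_dual[OF g Dist_plus_dual[OF \<mu>]] by (simp add: vanishing_def del: prod.lessThan_Suc)
  moreover have "Ad G R g \<mu> unit_function = 0"
    using \<mu> g by (simp add: Ad_apply unit_regular conj_fun_unit Dist_plus_iff)
  ultimately show ?thesis
    by (simp add: Dist_plus_iff)
qed

lemma Ad_dist_mult:
  assumes g: "g \<in> carrier G" and \<mu>: "\<mu> \<in> dual" and \<rho>: "\<rho> \<in> dual"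
  shows "Ad G R g (dist_mult G R \<mu> \<rho>) = dist_mult G R (Ad G R g \<mu>) (Ad G R g \<rho>)"
proof (rule dual_eqI)
  fix f assume f: "f \<in> R"
  obtain n :: nat and a b where ab: "\<And>i. i < n \<Longrightarrow> a i \<in> R" "\<And>i. i < n \<Longrightarrow> b i \<in> R"
    and eq: "comult G f = (\<Sum>i<n. pure_tensor (a i) (b i))"
    by (rule comultE[OF f]) (rule that; simp)
  have "dist_mult G R \<mu> \<rho> (conj_fun g f) = (\<Sum>i<n. \<mu> (conj_fun g (a i)) * \<rho> (conj_fun g (b i)))"
    using ab f g
    by (intro dist_mult_sum[OF \<mu> \<rho> _ _ _ comult_conj_fun[OF g eq]]) (simp_all add: conj_fun_regular)
  also have "\<dots> = (\<Sum>i<n. Ad G R g \<mu> (a i) * Ad G R g \<rho> (b i))"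
    using ab by (simp add: Ad_apply)
  also have "\<dots> = dist_mult G R (Ad G R g \<mu>) (Ad G R g \<rho>) f"
    using ab by (intro dist_mult_sum[OF Ad_dual[OF g \<mu>] Ad_dual[OF g \<rho>] f _ _ eq, symmetric]) simp_all
  finally show "Ad G R g (dist_mult G R \<mu> \<rho>) f = dist_mult G R (Ad G R g \<mu>) (Ad G R g \<rho>) f"
    using f by (simp add: Ad_apply)
qed (intro Ad_dual dist_mult_dual g \<mu> \<rho>)+


section \<open>Morphisms between higher enveloping algebras\<close>

lemma U_space_dual: "x \<in> U_space G R r \<Longrightarrow> x \<in> dual"
  unfolding U_space_def by (rule Dist_plus_dual)

lemma U_space_subspace: "fun_space.subspace (U_space G R r)"
  unfolding U_space_def by (rule Dist_plus_subspace)

lemma Dist_plus_U_space: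
  assumes "x \<in> Dist_plus G R i" "i < CHAR('k) ^ (r + 1)"
  shows "x \<in> U_space G R r"
proof -
  have "i \<le> CHAR('k) ^ (r + 1) - 1"
    using assms(2) by linarith
  then show ?thesis
    unfolding U_space_def using Dist_plus_mono assms(1) by blast
qed

lemma ring_U_tensor: "ring (tensor_algebra (U_space G R r))"
  by (rule ring_tensor_algebra[OF U_space_subspace])

lemma dist_bracket_U_space:
  assumes "CHAR('k) > 0" "x \<in> Dist_plus G R i" "y \<in> Dist_plus G R j" "i + j \<le> CHAR('k) ^ (r + 1)"
  shows "dist_bracket G R x y \<in> U_space G R r"
proof -
  have "i + j \<le> Suc (CHAR('k) ^ (r + 1) - 1)"
    using assms(4) by simp
  then show ?thesis
    unfolding U_space_def by (rule dist_bracket_Dist_plus[OF assms(2,3)])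
qed

text \<open>The point is that the right-hand sides belong to the generating space: for products by
  the strict degree bound, for brackets by the drop of one degree.\<close>

lemma U_relations_closed:
  assumes "CHAR('k) > 0"
  shows "U_relations G R r \<subseteq> carrier (tensor_algebra (U_space G R r))"
proof -
  interpret T: ring "tensor_algebra (U_space G R r)"
    by (rule ring_U_tensor)
  note gen = tensor_gen_closed[OF U_space_subspace]
  show ?thesis
    unfolding U_relations_def Let_def
    using assms
    by (auto intro!: T.minus_closed T.m_closed gen dist_bracket_U_space
        intro: Dist_plus_U_space Dist_plus_U_space[OF dist_mult_Dist_plus])
qed

lemma ideal_U_ideal:
  assumes "CHAR('k) > 0"
  shows "ideal (U_ideal G R r) (tensor_algebra (U_space G R r))"
  unfolding U_ideal_def by (intro ring.genideal_ideal ring_U_tensor U_relations_closed assms)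

end

text \<open>Multiplying the two floors by \<open>p ^ s\<close> gives at most \<open>i + j\<close>,
  while \<open>p ^ (r + 1)\<close> is an exact multiple of \<open>p ^ s\<close>. This bound and its
  weak variant carry the side conditions of the two families of relations from level
  \<open>r\<close> to level \<open>r - s\<close>.\<close>

lemma div_char_power_less:
  fixes p :: nat
  assumes "0 < p" "s \<le> r" "i + j < p ^ (r + 1)"
  shows "i div p ^ s + j div p ^ s < p ^ (r - s + 1)"
proof -
  have eq: "p ^ (r + 1) = p ^ (r - s + 1) * p ^ s"
    using assms(2) by (simp flip: power_add)
  have "(i div p ^ s + j div p ^ s) * p ^ s \<le> i + j"
    by (simp add: distrib_right add_mono)
  also have "\<dots> < p ^ (r - s + 1) * p ^ s"
    using assms(3) by (simp only: eq)
  finally show ?thesis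
    by simp
qed

lemma div_char_power_le:
  fixes p :: nat
  assumes "0 < p" "s \<le> r" "i + j \<le> p ^ (r + 1)"
  shows "i div p ^ s + j div p ^ s \<le> p ^ (r - s + 1)"
proof -
  have eq: "p ^ (r + 1) = p ^ (r - s + 1) * p ^ s"
    using assms(2) by (simp flip: power_add)
  have "(i div p ^ s + j div p ^ s) * p ^ s \<le> i + j"
    by (simp add: distrib_right add_mono)
  also have "\<dots> \<le> p ^ (r - s + 1) * p ^ s"
    using assms(3) by (simp only: eq)
  finally show ?thesis
    using assms(1) by simp
qed

text \<open>Both \<open>Ad g\<close>, with \<open>s = 0\<close>, and the Frobenius map on distributions are of this kind.\<close>

locale dist_morphism = affine_algebraic_group G R
  for G :: "('g, 'm) monoid_scheme" (structure) and R :: "('g \<Rightarrow> 'k::alg_closed_field) set" +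
  fixes h :: "(('g \<Rightarrow> 'k) \<Rightarrow> 'k) \<Rightarrow> (('g \<Rightarrow> 'k) \<Rightarrow> 'k)" and s :: nat
  assumes char_pos: "CHAR('k) > 0"
    and linear: "linear_on fun_scale dual h"
    and filtered: "x \<in> Dist_plus G R i \<Longrightarrow> h x \<in> Dist_plus G R (i div CHAR('k) ^ s)"
    and multiplicative: "\<lbrakk>x \<in> dual; y \<in> dual\<rbrakk> \<Longrightarrow> h (dist_mult G R x y) = dist_mult G R (h x) (h y)"
begin

lemma bracket:
  assumes "x \<in> dual" "y \<in> dual"
  shows "h (dist_bracket G R x y) = dist_bracket G R (h x) (h y)"
proof -
  let ?a = "dist_mult G R x y" and ?b = "dist_mult G R y x"
  have mem: "?a \<in> dual" "?b \<in> dual"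
    using assms by (auto intro: dist_mult_dual)
  have "h (?a + fun_scale (- 1) ?b) = h ?a + h (fun_scale (- 1) ?b)"
    by (intro linear_onD[OF linear] mem fun_space.subspace_scale[OF dual_subspace])
  moreover have "h (fun_scale (- 1) ?b) = fun_scale (- 1) (h ?b)"
    by (intro linear_onD[OF linear] mem)
  ultimately show ?thesis
    using assms by (simp add: dist_bracket_def multiplicative)
qed

context
  fixes r :: nat
  assumes s: "s \<le> r"
begin

abbreviation V where "V \<equiv> U_space G R r"
abbreviation V' where "V' \<equiv> U_space G R (r - s)"

lemma image_U_space: "h ` V \<subseteq> V'"
proof -
  have "(CHAR('k) ^ (r + 1) - 1) div CHAR('k) ^ s < CHAR('k) ^ (r - s + 1)"
    using div_char_power_less[OF char_pos s, of "CHAR('k) ^ (r + 1) - 1" 0] char_pos by simp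
  then show ?thesis
    using filtered Dist_plus_U_space unfolding U_space_def[of G R r] by blast
qed

lemma linear_U_space: "linear_on fun_scale V h"
  using linear U_space_dual unfolding linear_on_def by blast

lemmas U_tensor_map = U_space_subspace U_space_subspace linear_U_space image_U_space

text \<open>Each relation goes to the relation of the same family for the images of its two
  elements, with both degrees divided by \<open>p ^ s\<close>.\<close>

lemma tensor_map_U_relations:
  "tensor_map V' h ` U_relations G R r \<subseteq> U_relations G R (r - s)"
proof -
  let ?T = "tensor_algebra V" and ?T' = "tensor_algebra V'"
  let ?g = "tensor_gen V" and ?g' = "tensor_gen V'"
  interpret \<phi>: ring_hom_ring ?T ?T' "tensor_map V' h"
    by (rule tensor_map_ring_hom[OF U_tensor_map])
  note gen = tensor_gen_closed[OF U_space_subspace]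
  note map_gen = tensor_map_gen[OF U_tensor_map]
  have hom_minus: "tensor_map V' h (a \<ominus>\<^bsub>?T\<^esub> b) = tensor_map V' h a \<ominus>\<^bsub>?T'\<^esub> tensor_map V' h b"
    if "a \<in> carrier ?T" "b \<in> carrier ?T" for a b
    using that by (simp add: a_minus_def)
  have 1: "tensor_map V' h (?g x \<otimes>\<^bsub>?T\<^esub> ?g y \<ominus>\<^bsub>?T\<^esub> ?g (dist_mult G R x y)) \<in> U_relations G R (r - s)"
    if x: "x \<in> Dist_plus G R i" and y: "y \<in> Dist_plus G R j" and ij: "i + j < CHAR('k) ^ (r + 1)" for x y i j
  proof -
    have mem: "x \<in> V" "y \<in> V" "dist_mult G R x y \<in> V"
      using Dist_plus_U_space[OF x] Dist_plus_U_space[OF y]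
        Dist_plus_U_space[OF dist_mult_Dist_plus[OF x y]] ij by simp_all
    then have "tensor_map V' h (?g x \<otimes>\<^bsub>?T\<^esub> ?g y \<ominus>\<^bsub>?T\<^esub> ?g (dist_mult G R x y))
        = ?g' (h x) \<otimes>\<^bsub>?T'\<^esub> ?g' (h y) \<ominus>\<^bsub>?T'\<^esub> ?g' (dist_mult G R (h x) (h y))"
      by (simp add: hom_minus gen map_gen multiplicative U_space_dual)
    with filtered[OF x] filtered[OF y] div_char_power_less[OF char_pos s ij] show ?thesis
      unfolding U_relations_def Let_def by blast
  qed
  have 2: "tensor_map V' h ((?g x \<otimes>\<^bsub>?T\<^esub> ?g y \<ominus>\<^bsub>?T\<^esub> ?g y \<otimes>\<^bsub>?T\<^esub> ?g x) \<ominus>\<^bsub>?T\<^esub> ?g (dist_bracket G R x y))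
      \<in> U_relations G R (r - s)"
    if x: "x \<in> Dist_plus G R i" and y: "y \<in> Dist_plus G R j" and ij: "i + j \<le> CHAR('k) ^ (r + 1)"
      and xV: "x \<in> V" and yV: "y \<in> V" for x y i j
  proof -
    have "tensor_map V' h ((?g x \<otimes>\<^bsub>?T\<^esub> ?g y \<ominus>\<^bsub>?T\<^esub> ?g y \<otimes>\<^bsub>?T\<^esub> ?g x) \<ominus>\<^bsub>?T\<^esub> ?g (dist_bracket G R x y))
        = (?g' (h x) \<otimes>\<^bsub>?T'\<^esub> ?g' (h y) \<ominus>\<^bsub>?T'\<^esub> ?g' (h y) \<otimes>\<^bsub>?T'\<^esub> ?g' (h x))
          \<ominus>\<^bsub>?T'\<^esub> ?g' (dist_bracket G R (h x) (h y))"
      using dist_bracket_U_space[OF char_pos x y ij] xV yV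
      by (simp add: hom_minus gen map_gen bracket U_space_dual)
    \<comment> \<open>The second family asks for membership separately: if one degree is 0, the
      bound on the sum does not force the other element into the generating space.\<close>
    moreover have "h x \<in> V'" "h y \<in> V'"
      using image_U_space xV yV by auto
    ultimately show ?thesis
      using filtered[OF x] filtered[OF y] div_char_power_le[OF char_pos s ij]
      unfolding U_relations_def Let_def by blast
  qed
  show ?thesis
    unfolding U_relations_def[of G R r] Let_def using 1 2 by blast
qed

lemma tensor_map_U_ideal: "tensor_map V' h ` U_ideal G R r \<subseteq> U_ideal G R (r - s)"
proof -
  interpret ring_hom_ring "tensor_algebra V" "tensor_algebra V'" "tensor_map V' h"
    by (rule tensor_map_ring_hom[OF U_tensor_map])
  have "U_relations G R (r - s) \<subseteq> U_ideal G R (r - s)"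
    unfolding U_ideal_def by (rule S.genideal_self[OF U_relations_closed[OF char_pos]])
  then show ?thesis
    unfolding U_ideal_def[of G R r]
    using image_genideal_subset[OF U_relations_closed[OF char_pos] _ ideal_U_ideal[OF char_pos]]
      tensor_map_U_relations by blast
qed

lemma U_map_closed:
  "x \<in> carrier (U_algebra G R r) \<Longrightarrow> U_map G R (r - s) h x \<in> carrier (U_algebra G R (r - s))"
  using ring_hom_closed[OF ring_hom_ring.homh[OF quotient_map_ring_hom[OF tensor_map_ring_hom[OF U_tensor_map]
      ideal_U_ideal[OF char_pos] ideal_U_ideal[OF char_pos] tensor_map_U_ideal]]]
  unfolding U_map_def U_algebra_def .

text \<open>Elements of the enveloping algebra are cosets of cosets of some \<open>t\<close> in the
  free algebra. On such a \<open>t\<close> every induced map is plain \<open>free_map\<close>, which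
  brings the final comparison down to the free algebra.\<close>

lemma U_map_coset:
  assumes "t \<in> carrier (free_algebra V)"
  shows "U_map G R (r - s) h
      (U_ideal G R r +>\<^bsub>tensor_algebra V\<^esub> (tensor_ideal V +>\<^bsub>free_algebra V\<^esub> t))
    = U_ideal G R (r - s) +>\<^bsub>tensor_algebra V'\<^esub> (tensor_ideal V' +>\<^bsub>free_algebra V'\<^esub> free_map h t)"
proof -
  have "tensor_ideal V +>\<^bsub>free_algebra V\<^esub> t \<in> carrier (tensor_algebra V)"
    using assms ring_hom_closed[OF ideal.rcos_ring_hom[OF ideal_tensor_ideal[OF U_space_subspace]]]
    by (simp add: tensor_algebra_def)
  then show ?thesis
    unfolding U_map_def
    using quotient_map_coset[OF tensor_map_ring_hom[OF U_tensor_map] ideal_U_ideal[OF char_pos]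
        ideal_U_ideal[OF char_pos] tensor_map_U_ideal]
    by (simp add: tensor_map_coset[OF U_tensor_map assms])
qed

end

end

lemma U_algebraE:
  assumes "x \<in> carrier (U_algebra G R r)"
  obtains t where "t \<in> carrier (free_algebra (U_space G R r))"
    "x = U_ideal G R r +>\<^bsub>tensor_algebra (U_space G R r)\<^esub>
       (tensor_ideal (U_space G R r) +>\<^bsub>free_algebra (U_space G R r)\<^esub> t)"
proof -
  obtain X where X: "X \<in> carrier (tensor_algebra (U_space G R r))"
    and x: "x = U_ideal G R r +>\<^bsub>tensor_algebra (U_space G R r)\<^esub> X"
    using assms unfolding U_algebra_def by (rule quotient_carrierE)
  obtain t where "t \<in> carrier (free_algebra (U_space G R r))"
    "X = tensor_ideal (U_space G R r) +>\<^bsub>free_algebra (U_space G R r)\<^esub> t"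
    using X unfolding tensor_algebra_def by (rule quotient_carrierE)
  with x that show ?thesis
    by blast
qed

lemma (in affine_algebraic_group) dist_morphism_Ad:
  "CHAR('k) > 0 \<Longrightarrow> g \<in> carrier G \<Longrightarrow> dist_morphism G R (Ad G R g) 0"
  by unfold_locales (simp_all add: Ad_linear Ad_Dist_plus Ad_dist_mult)


section \<open>The geometric Frobenius\<close>

locale frobenius_form = affine_algebraic_group G R
  for G :: "('g, 'm) monoid_scheme" (structure) and R :: "('g \<Rightarrow> 'k::alg_closed_field) set" +
  fixes B :: "('g \<Rightarrow> 'k) set" and s q :: nat
  assumes char_pos: "CHAR('k) > 0"
    and q: "q = CHAR('k) ^ s"
    and form: "prime_field_form G R B"
begin

abbreviation Fr :: "('g \<Rightarrow> 'k) \<Rightarrow> 'g \<Rightarrow> 'k"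
  where "Fr \<equiv> frob_comorphism R B s"

abbreviation \<Xi> :: "(('g \<Rightarrow> 'k) \<Rightarrow> 'k) \<Rightarrow> ('g \<Rightarrow> 'k) \<Rightarrow> 'k"
  where "\<Xi> \<equiv> dist_frob R B s"

lemma q_pos: "0 < q"
  using char_pos by (simp add: q)

lemma q_eq_Suc: obtains m where "q = Suc m"
  using q_pos gr0_implies_Suc by blast

lemma B_regular: "b \<in> B \<Longrightarrow> b \<in> R"
  and unit_B: "unit_function \<in> B"
  and B_mult: "b \<in> B \<Longrightarrow> b' \<in> B \<Longrightarrow> b * b' \<in> B"
  and B_one: "b \<in> B \<Longrightarrow> b \<one> \<in> range of_int"
  and span_B: "fun_space.span B = R"
  and B_comult: "b \<in> B \<Longrightarrow> comult G b \<in> tensor_square B"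
  using form by (auto simp: prime_field_form_def)

text \<open>Applied in contrapositive form: a finite subset of \<open>B\<close> that is dependent
  over the large field has a nontrivial relation with coefficients in the prime field.\<close>

lemma B_independent:
  assumes "S \<subseteq> B" "finite S"
    and "\<And>c. c ` S \<subseteq> range of_int \<Longrightarrow> (\<Sum>b\<in>S. fun_scale (c b) b) = 0 \<Longrightarrow> \<forall>b\<in>S. c b = 0"
  shows "fun_space.independent S"
proof -
  have "\<forall>S\<subseteq>B. finite S \<and>
      (\<forall>c. c ` S \<subseteq> range of_int \<and> (\<Sum>b\<in>S. fun_scale (c b) b) = 0 \<longrightarrow> (\<forall>b\<in>S. c b = 0))
      \<longrightarrow> fun_space.independent S"
    using form unfolding prime_field_form_def by (elim conjE)
  then show ?thesis
  proof (rule allE[of _ S])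
    assume imp: "S \<subseteq> B \<longrightarrow> finite S \<and>
      (\<forall>c. c ` S \<subseteq> range of_int \<and> (\<Sum>b\<in>S. fun_scale (c b) b) = 0 \<longrightarrow> (\<forall>b\<in>S. c b = 0))
      \<longrightarrow> fun_space.independent S"
    have "\<forall>c. c ` S \<subseteq> range of_int \<and> (\<Sum>b\<in>S. fun_scale (c b) b) = 0 \<longrightarrow> (\<forall>b\<in>S. c b = 0)"
      by (intro allI impI, elim conjE, rule assms(3))
    then show ?thesis
      by (rule mp[OF mp[OF imp assms(1)] conjI[OF assms(2)]])
  qed
qed

section \<open>The power map with exponent \<open>q\<close> and the prime field\<close>

lemma power_fun_apply: "(f ^ n) x = f x ^ n" for f :: "'a \<Rightarrow> 'k"
  by (induction n) auto

lemma power_q_add: "(x + y) ^ q = x ^ q + y ^ q" for x y :: 'k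
  using freshmans_dream'[OF prime_CHAR_semidom[OF char_pos] q] .

lemma power_q_sum: "(\<Sum>i\<in>A. f i) ^ q = (\<Sum>i\<in>A. f i ^ q)" for f :: "'a \<Rightarrow> 'k"
  using freshmans_dream_sum'[OF prime_CHAR_semidom[OF char_pos] q] .

text \<open>An additive map that fixes 1 fixes all natural numbers; negative integers follow by
  cancelling against a natural number.\<close>

lemma power_q_prime_field:
  assumes "c \<in> range of_int"
  shows "c ^ q = (c::'k)"
proof -
  have nat: "of_nat n ^ q = (of_nat n :: 'k)" for n
    using q_pos by (induction n) (simp_all add: power_q_add)
  obtain z where c: "c = of_int z"
    using assms by blast
  show ?thesis
  proof (cases "0 \<le> z")
    case True
    then show ?thesis
      using nat[of "nat z"] by (simp add: c)
  next
    case False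
    then have "c + of_nat (nat (- z)) = 0"
      by (simp add: c)
    moreover have "(c + of_nat (nat (- z))) ^ q = c ^ q + of_nat (nat (- z))"
      by (simp add: power_q_add nat)
    ultimately have "c ^ q + of_nat (nat (- z)) = c + of_nat (nat (- z))"
      using q_pos by (simp add: zero_power)
    then show ?thesis
      by simp
  qed
qed

lemma power_q_lincomb:
  "(\<Sum>b\<in>S. fun_scale (c b) (f b)) ^ q = (\<Sum>b\<in>S. fun_scale (c b ^ q) (f b ^ q))"
  for f :: "'b \<Rightarrow> 'a \<Rightarrow> 'k"
  by (simp add: fun_eq_iff power_fun_apply sum_fun_apply power_q_sum power_mult_distrib)

text \<open>
  A linear relation among elements of the form remains valid for their \<open>q\<close>-th powers: subtract
  multiples of relations over the prime field, which are invariant, to decrease the support.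
\<close>

lemma relation_power_q:
  assumes "finite S" "S \<subseteq> B" "(\<Sum>b\<in>S. fun_scale (c b) b) = 0"
  shows "(\<Sum>b\<in>S. fun_scale (c b) (b ^ q)) = 0"
  using assms
proof (induction S arbitrary: c rule: finite_psubset_induct)
  case (psubset S)
  have relation: "(\<Sum>b\<in>S. fun_scale (c b) b) = 0"
    using psubset.prems(2) .
  have "(\<Sum>b\<in>S. fun_scale (c b) (b ^ q)) = 0"
  proof (cases "\<forall>b\<in>S. c b = 0")
    case True
    then have "(\<Sum>b\<in>S. fun_scale (c b) (b ^ q)) = (\<Sum>b\<in>S. 0)"
      by (intro sum.cong) (simp_all add: fun_eq_iff)
    also have "\<dots> = 0"
      by simp
    finally show ?thesis .
  next
    case False
    then have "\<not> fun_space.independent S"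
      using relation fun_space.dependent_finite[OF psubset.hyps(1)] by blast
    then obtain n where n: "n ` S \<subseteq> range of_int" "(\<Sum>b\<in>S. fun_scale (n b) b) = 0"
      and "\<not> (\<forall>b\<in>S. n b = 0)"
      using B_independent[OF psubset.prems(1) psubset.hyps(1)] by blast
    then obtain b0 where b0: "b0 \<in> S" "n b0 \<noteq> 0"
      by blast
    have "(\<Sum>b\<in>S. fun_scale (n b ^ q) (b ^ q)) = 0"
      using power_q_lincomb[of n "\<lambda>b. b" S] n(2) q_pos by (simp add: zero_power)
    moreover have "n b ^ q = n b" if "b \<in> S" for b
      using that n(1) by (intro power_q_prime_field) blast
    ultimately have nq: "(\<Sum>b\<in>S. fun_scale (n b) (b ^ q)) = 0"
      by simp
    \<comment> \<open>This choice clears the coefficient at \<open>b0\<close>. The factor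
      \<open>k\<close> lies in the large field, which is allowed: the relation with coefficients
      \<open>n\<close> already holds for the elements and for their powers, and both versions may be
      scaled.\<close>
    define k where "k = c b0 / n b0"
    define c' where "c' b = c b - k * n b" for b
    have split: "(\<Sum>b\<in>S. fun_scale (c' b) (f b))
        = (\<Sum>b\<in>S. fun_scale (c b) (f b)) - fun_scale k (\<Sum>b\<in>S. fun_scale (n b) (f b))"
      for f :: "('g \<Rightarrow> 'k) \<Rightarrow> 'g \<Rightarrow> 'k"
      by (simp add: c'_def fun_eq_iff sum_fun_apply left_diff_distrib sum_subtractf sum_distrib_left mult.assoc)
    have "c' b0 = 0"
      using b0 by (simp add: c'_def k_def)
    then have remove: "(\<Sum>b\<in>S. fun_scale (c' b) (f b)) = (\<Sum>b\<in>S - {b0}. fun_scale (c' b) (f b))"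
      for f :: "('g \<Rightarrow> 'k) \<Rightarrow> 'g \<Rightarrow> 'k"
      using psubset.hyps(1) by (intro sum.mono_neutral_right) (auto simp: fun_eq_iff)
    have "(\<Sum>b\<in>S - {b0}. fun_scale (c' b) b) = 0"
      using split[of "\<lambda>b. b"] remove[of "\<lambda>b. b"] n(2) relation by simp
    moreover have "S - {b0} \<subset> S" "S - {b0} \<subseteq> B"
      using b0 psubset.prems(1) by auto
    ultimately have "(\<Sum>b\<in>S - {b0}. fun_scale (c' b) (b ^ q)) = 0"
      by (intro psubset.IH)
    then show ?thesis
      using split[of "\<lambda>b. b ^ q"] remove[of "\<lambda>b. b ^ q"] nq by simp
  qed
  then show ?case .
qed

text \<open>Since \<open>B\<close> need not be closed under scalars of the large field, elements of
  \<open>R\<close> are built up by adding one scaled element of \<open>B\<close> at a time.\<close>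

lemma form_induct [consumes 1, case_names zero step]:
  assumes "f \<in> R" "P 0"
    and "\<And>c b f. b \<in> B \<Longrightarrow> f \<in> R \<Longrightarrow> P f \<Longrightarrow> P (fun_scale c b + f)"
  shows "P f"
proof -
  have "f \<in> R \<and> P f"
    using assms(1)[folded span_B]
  proof (rule fun_space.span_induct_alt[where h = "\<lambda>f. f \<in> R \<and> P f"])
    show "0 \<in> R \<and> P 0"
      using assms(2) regular_zero by blast
    show "fun_scale c b + f \<in> R \<and> P (fun_scale c b + f)" if "b \<in> B" "f \<in> R \<and> P f" for c b f
      using that assms(3) B_regular regular_add regular_scale by blast
  qed
  then show ?thesis ..
qed

text \<open>The values are prescribed on a maximal independent subset \<open>C\<close> of
  \<open>B\<close> and extended linearly. This forces the values on the rest of \<open>B\<close>,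
  and \<open>relation_power_q\<close> says that they are the right ones.\<close>

lemma frob_comorphism_exists:
  "\<exists>\<phi>. linear_on fun_scale R \<phi> \<and> (\<forall>f. f \<notin> R \<longrightarrow> \<phi> f = 0) \<and> (\<forall>f\<in>B. \<phi> f = f ^ q)"
proof -
  interpret fun_pair: vector_space_pair
    "fun_scale :: 'k \<Rightarrow> ('g \<Rightarrow> 'k) \<Rightarrow> 'g \<Rightarrow> 'k" "fun_scale :: 'k \<Rightarrow> ('g \<Rightarrow> 'k) \<Rightarrow> 'g \<Rightarrow> 'k" ..
  obtain C where C: "C \<subseteq> B" "fun_space.independent C" "B \<subseteq> fun_space.span C"
    using fun_space.maximal_independent_subset[of B] by blast
  define \<psi> where "\<psi> = fun_pair.construct C (\<lambda>b. b ^ q)"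
  have "Vector_Spaces.linear fun_scale fun_scale \<psi>"
    unfolding \<psi>_def by (rule fun_pair.linear_construct[OF C(2)])
  then interpret \<psi>: Vector_Spaces.linear fun_scale fun_scale \<psi> .
  have C_eq: "\<psi> a = a ^ q" if "a \<in> C" for a
    unfolding \<psi>_def by (rule fun_pair.construct_basis[OF C(2) that])
  have "\<psi> b = b ^ q" if b: "b \<in> B" for b
  proof (cases "b \<in> C")
    case False
    obtain t k where t: "finite t" "t \<subseteq> C" "b = (\<Sum>a\<in>t. fun_scale (k a) a)"
      using b C(3) unfolding fun_space.span_explicit by blast
    have "b \<notin> t"
      using False t(2) by blast
    \<comment> \<open>The coefficient -1 turns the expansion of \<open>b\<close> in terms of
      \<open>C\<close> into a linear relation on \<open>insert b t\<close>.\<close>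
    define c where "c a = (if a = b then - 1 else k a)" for a
    have c: "c b = - 1" and "\<And>a. a \<in> t \<Longrightarrow> c a = k a"
      using \<open>b \<notin> t\<close> by (auto simp: c_def)
    then have sum: "(\<Sum>a\<in>insert b t. fun_scale (c a) (f a)) = (\<Sum>a\<in>t. fun_scale (k a) (f a)) - f b"
      for f :: "('g \<Rightarrow> 'k) \<Rightarrow> 'g \<Rightarrow> 'k"
      using t(1) \<open>b \<notin> t\<close> by (simp add: fun_scale_minus_one)
    have "(\<Sum>a\<in>insert b t. fun_scale (c a) (a ^ q)) = 0"
    proof (rule relation_power_q)
      show "finite (insert b t)" "insert b t \<subseteq> B"
        using t C(1) b by auto
      show "(\<Sum>a\<in>insert b t. fun_scale (c a) a) = 0"
        using sum[of "\<lambda>a. a"] t(3) by simp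
    qed
    then have "b ^ q = (\<Sum>a\<in>t. fun_scale (k a) (a ^ q))"
      using sum[of "\<lambda>a. a ^ q"] by simp
    also have "\<dots> = (\<Sum>a\<in>t. fun_scale (k a) (\<psi> a))"
      using t(2) C_eq by (intro sum.cong) auto
    also have "\<dots> = \<psi> b"
      by (subst t(3)) (simp only: \<psi>.sum \<psi>.scale)
    finally show ?thesis ..
  qed (rule C_eq)
  then have "linear_on fun_scale R (\<lambda>f. if f \<in> R then \<psi> f else 0) \<and>
      (\<forall>f\<in>B. (if f \<in> R then \<psi> f else 0) = f ^ q)"
    using B_regular regular_add regular_scale by (simp add: linear_on_def \<psi>.add \<psi>.scale)
  then show ?thesis
    by (intro exI[of _ "\<lambda>f. if f \<in> R then \<psi> f else 0"]) simp
qed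

lemma linear_on_form_eqI:
  assumes \<phi>: "linear_on fun_scale R \<phi>" and \<psi>: "linear_on fun_scale R \<psi>"
    and eq: "\<And>b. b \<in> B \<Longrightarrow> \<phi> b = \<psi> b" and f: "f \<in> R"
  shows "\<phi> f = \<psi> f"
  using f
proof (induction rule: form_induct)
  case zero
  have "\<phi> (fun_scale 0 unit_function) = \<psi> (fun_scale 0 unit_function)"
    by (simp only: linear_onD[OF \<phi>] linear_onD[OF \<psi>] unit_regular eq unit_B)
  moreover have "fun_scale 0 unit_function = (0 :: 'g \<Rightarrow> 'k)"
    by (simp add: fun_eq_iff)
  ultimately show ?case
    by metis
next
  case (step c b f)
  then show ?case
    by (metis linear_onD[OF \<phi>] linear_onD[OF \<psi>] eq B_regular regular_scale)
qed

section \<open>The comorphism as an algebra endomorphism\<close>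

lemma Fr_spec:
  "linear_on fun_scale R Fr \<and> (\<forall>f. f \<notin> R \<longrightarrow> Fr f = 0) \<and> (\<forall>f\<in>B. Fr f = f ^ q)"
proof -
  let ?P = "\<lambda>\<phi>. linear_on fun_scale R \<phi> \<and> (\<forall>f. f \<notin> R \<longrightarrow> \<phi> f = 0) \<and> (\<forall>f\<in>B. \<phi> f = f ^ q)"
  have "\<exists>!\<phi>. ?P \<phi>"
  proof (rule ex_ex1I[OF frob_comorphism_exists])
    fix \<phi> \<psi> :: "('g \<Rightarrow> 'k) \<Rightarrow> 'g \<Rightarrow> 'k"
    assume "?P \<phi>" "?P \<psi>"
    then have "\<phi> f = \<psi> f" for f
      using linear_on_form_eqI[of \<phi> \<psi> f] by (cases "f \<in> R") auto
    then show "\<phi> = \<psi>"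
      by (rule ext)
  qed
  from theI'[OF this] show ?thesis
    unfolding frob_comorphism_def q[symmetric] .
qed

lemma Fr_linear: "linear_on fun_scale R Fr"
  and Fr_B: "b \<in> B \<Longrightarrow> Fr b = b ^ q"
  using Fr_spec by blast+

lemmas Fr_add = linear_onD(1)[OF Fr_linear]
lemmas Fr_scale = linear_onD(2)[OF Fr_linear]

lemma Fr_zero: "Fr 0 = 0"
proof -
  have "Fr (0 + 0) = Fr 0 + Fr 0"
    using Fr_add regular_zero by blast
  then show ?thesis
    by simp
qed

lemma B_power_q_regular: "b \<in> B \<Longrightarrow> b ^ q \<in> R"
  using q_eq_Suc power_closed B_regular by metis

lemma Fr_regular: "f \<in> R \<Longrightarrow> Fr f \<in> R"
proof (induction rule: form_induct)
  case zero
  show ?case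
    unfolding Fr_zero by (rule regular_zero)
next
  case (step c b f)
  then have "fun_scale c (b ^ q) + Fr f \<in> R"
    using B_power_q_regular regular_add regular_scale by blast
  with step show ?case
    by (simp only: Fr_add Fr_scale B_regular regular_scale Fr_B)
qed

lemma Fr_unit: "Fr unit_function = unit_function"
  using q_pos by (auto simp: Fr_B unit_B fun_eq_iff power_fun_apply indicator_def zero_power)

text \<open>Both sides are bilinear, and on \<open>B\<close> the power of a product is the product
  of the powers; hence one span induction for each factor.\<close>

lemma Fr_mult:
  assumes f: "f \<in> R" and g: "g \<in> R"
  shows "Fr (f * g) = Fr f * Fr g"
proof -
  have scale_mult: "fun_scale c a * b = fun_scale c (a * b)" "b * fun_scale c a = fun_scale c (b * a)"
    for c and a b :: "'g \<Rightarrow> 'k"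
    by (auto simp: fun_eq_iff)
  have base: "Fr (b * g) = b ^ q * Fr g" if b: "b \<in> B" for b
    using g
  proof (induction rule: form_induct)
    case zero
    show ?case
      by (simp only: mult_zero_right Fr_zero)
  next
    case (step c b' g)
    have "Fr (b * (fun_scale c b' + g)) = Fr (fun_scale c (b * b') + b * g)"
      by (simp only: distrib_left scale_mult)
    also have "\<dots> = fun_scale c ((b * b') ^ q) + b ^ q * Fr g"
      using step b by (simp only: Fr_add Fr_scale Fr_B B_mult B_regular regular_scale mult_closed)
    also have "\<dots> = b ^ q * Fr (fun_scale c b' + g)"
      using step by (simp only: Fr_add Fr_scale Fr_B B_regular regular_scale distrib_left scale_mult
          power_mult_distrib)
    finally show ?case .
  qed
  show ?thesis
    using f
  proof (induction rule: form_induct)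
    case zero
    show ?case
      by (simp only: mult_zero_left Fr_zero)
  next
    case (step c b f)
    have "Fr ((fun_scale c b + f) * g) = Fr (fun_scale c (b * g) + f * g)"
      by (simp only: distrib_right scale_mult)
    also have "\<dots> = fun_scale c (b ^ q * Fr g) + Fr f * Fr g"
      using step g by (simp only: Fr_add Fr_scale base B_regular regular_scale mult_closed)
    also have "\<dots> = Fr (fun_scale c b + f) * Fr g"
      using step by (simp only: Fr_add Fr_scale Fr_B B_regular regular_scale distrib_right scale_mult)
    finally show ?case .
  qed
qed

text \<open>Taking the power \<open>q\<close> is additive for functions on pairs too, so it can be
  applied to each factor of the coproduct. The two decompositions are delivered together because
  their factors have to match.\<close>

lemma B_comultE:
  assumes "b \<in> B"
  obtains n :: nat and a c where "\<And>i. i < n \<Longrightarrow> a i \<in> B" "\<And>i. i < n \<Longrightarrow> c i \<in> B"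
    "comult G b = (\<Sum>i<n. pure_tensor (a i) (c i))"
    "comult G (b ^ q) = (\<Sum>i<n. pure_tensor (a i ^ q) (c i ^ q))"
proof -
  obtain n :: nat and a c where ac: "\<forall>i<n. a i \<in> B \<and> c i \<in> B"
    and eq: "comult G b = (\<Sum>i<n. pure_tensor (a i) (c i))"
    using B_comult[OF assms] by (auto simp: tensor_square_def)
  have "comult G (b ^ q) = comult G b ^ q"
    using q_pos by (auto simp: fun_eq_iff comult_def power_fun_apply zero_power)
  also have "\<dots> = (\<Sum>i<n. pure_tensor (a i ^ q) (c i ^ q))"
    by (auto simp: eq fun_eq_iff power_fun_apply sum_fun_apply power_q_sum pure_tensor_def power_mult_distrib)
  finally show ?thesis
    using that ac eq by blast
qed

section \<open>The geometric Frobenius on points\<close>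

abbreviation F :: "'g \<Rightarrow> 'g"
  where "F \<equiv> geom_frob G R B s"

text \<open>The comorphism followed by evaluation at \<open>g\<close> is an algebra homomorphism to
  the field, so \<open>points\<close> makes it evaluation at a point, and \<open>separating\<close>
  makes that point unique.\<close>

lemma F_spec:
  assumes "g \<in> carrier G"
  shows "F g \<in> carrier G \<and> (\<forall>f\<in>R. f (F g) = Fr f g)"
  unfolding geom_frob_def
proof (rule theI')
  have "\<exists>h\<in>carrier G. \<forall>f\<in>R. Fr f g = f h"
  proof (rule points)
    show "linear_on (*) R (\<lambda>f. Fr f g)"
      by (simp add: linear_on_def Fr_add Fr_scale)
  qed (use assms in \<open>simp_all add: Fr_mult Fr_unit\<close>)
  then show "\<exists>!h. h \<in> carrier G \<and> (\<forall>f\<in>R. f h = Fr f g)"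
    using separating by metis
qed

lemma F_closed: "g \<in> carrier G \<Longrightarrow> F g \<in> carrier G"
  and F_eval: "g \<in> carrier G \<Longrightarrow> f \<in> R \<Longrightarrow> f (F g) = Fr f g"
  using F_spec by blast+

text \<open>Regular functions separate points, and the identity to be tested is linear in
  \<open>f\<close>; for \<open>f\<close> in \<open>B\<close> it is the matching pair of coproducts
  from \<open>B_comultE\<close>.\<close>

lemma F_mult:
  assumes x: "x \<in> carrier G" and y: "y \<in> carrier G"
  shows "F (x \<otimes> y) = F x \<otimes> F y"
proof (rule separating)
  fix f assume "f \<in> R"
  then have "Fr f (x \<otimes> y) = f (F x \<otimes> F y)"
  proof (induction rule: form_induct)
    case zero
    have "Fr 0 (x \<otimes> y) = 0 (F x \<otimes> F y)"
      by (simp only: Fr_zero zero_fun_apply)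
    then show ?case .
  next
    case (step c b f)
    obtain n :: nat and a d where ad: "\<And>i. i < n \<Longrightarrow> a i \<in> B" "\<And>i. i < n \<Longrightarrow> d i \<in> B"
      and eq: "comult G b = (\<Sum>i<n. pure_tensor (a i) (d i))"
      and eq': "comult G (b ^ q) = (\<Sum>i<n. pure_tensor (a i ^ q) (d i ^ q))"
      by (rule B_comultE[OF step(1)]) (rule that; simp)
    have "Fr b (x \<otimes> y) = (\<Sum>i<n. (a i ^ q) x * (d i ^ q) y)"
      using fun_cong[OF eq', of "(x, y)"] step(1) x y
      by (simp add: Fr_B comult_def sum_fun_apply pure_tensor_def)
    also have "\<dots> = (\<Sum>i<n. a i (F x) * d i (F y))"
      using ad x y by (simp add: F_eval B_regular Fr_B)
    also have "\<dots> = b (F x \<otimes> F y)"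
      using fun_cong[OF eq, of "(F x, F y)"] x y
      by (simp add: F_closed comult_def sum_fun_apply pure_tensor_def)
    finally have "Fr b (x \<otimes> y) = b (F x \<otimes> F y)" .
    with step have "Fr (fun_scale c b + f) (x \<otimes> y) = (fun_scale c b + f) (F x \<otimes> F y)"
      by (simp add: Fr_add Fr_scale B_regular regular_scale)
    then show ?case .
  qed
  then show "f (F (x \<otimes> y)) = f (F x \<otimes> F y)"
    using x y \<open>f \<in> R\<close> by (simp add: F_eval)
qed (use x y in \<open>simp_all add: F_closed\<close>)

lemma F_conj:
  assumes "g \<in> carrier G" "x \<in> carrier G"
  shows "F (g \<otimes> x \<otimes> inv g) = F g \<otimes> F x \<otimes> inv (F g)"
proof -
  interpret group_hom G G F
    by unfold_locales (auto simp: hom_def F_closed F_mult)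
  show ?thesis
    using assms by simp
qed

text \<open>At points of the group this is \<open>F_conj\<close> read through \<open>F_eval\<close>;
  off the carrier both sides are 0.\<close>

lemma Fr_conj_fun:
  assumes g: "g \<in> carrier G" and f: "f \<in> R"
  shows "Fr (conj_fun (F g) f) = conj_fun g (Fr f)"
proof
  fix x
  have reg: "conj_fun (F g) f \<in> R"
    using f g by (simp add: conj_fun_regular F_closed)
  show "Fr (conj_fun (F g) f) x = conj_fun g (Fr f) x"
  proof (cases "x \<in> carrier G")
    case True
    then have "Fr (conj_fun (F g) f) x = f (F (g \<otimes> x \<otimes> inv g))"
      using reg g by (simp add: pull_def F_closed F_conj flip: F_eval)
    also have "\<dots> = conj_fun g (Fr f) x"
      using True g f by (simp add: F_eval pull_def)
    finally show ?thesis .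
  next
    case False
    then show ?thesis
      using regular_outside[OF Fr_regular[OF reg]] by (simp add: pull_def)
  qed
qed

section \<open>The Frobenius map on distributions\<close>

lemma \<Xi>_apply: "f \<in> R \<Longrightarrow> \<Xi> \<mu> f = \<mu> (Fr f)"
  by (simp add: dist_frob_def)

lemma \<Xi>_linear: "linear_on fun_scale dual \<Xi>"
  by (auto simp: linear_on_def dist_frob_def fun_eq_iff)

lemma \<Xi>_dual:
  assumes "\<mu> \<in> dual"
  shows "\<Xi> \<mu> \<in> dual"
  by (rule dualI)
    (simp_all add: dist_frob_def regular_add regular_scale Fr_add Fr_scale Fr_regular
      dual_add[OF assms] dual_scale[OF assms])

lemma \<Xi>_Ad:
  assumes g: "g \<in> carrier G" and \<mu>: "\<mu> \<in> dual"
  shows "\<Xi> (Ad G R g \<mu>) = Ad G R (F g) (\<Xi> \<mu>)"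
proof (rule dual_eqI)
  fix f assume "f \<in> R"
  then show "\<Xi> (Ad G R g \<mu>) f = Ad G R (F g) (\<Xi> \<mu>) f"
    using g by (simp add: \<Xi>_apply Ad_apply Fr_regular conj_fun_regular F_closed Fr_conj_fun)
qed (intro \<Xi>_dual Ad_dual g \<mu> F_closed)+

text \<open>Transpose of the compatibility of the comorphism with coproducts. That compatibility is
  available on \<open>B\<close> only, which is enough because both sides are linear in
  \<open>f\<close>.\<close>

lemma \<Xi>_dist_mult:
  assumes \<mu>: "\<mu> \<in> dual" and \<rho>: "\<rho> \<in> dual"
  shows "\<Xi> (dist_mult G R \<mu> \<rho>) = dist_mult G R (\<Xi> \<mu>) (\<Xi> \<rho>)"
proof (rule dual_eqI)
  have l: "\<Xi> (dist_mult G R \<mu> \<rho>) \<in> dual" and r: "dist_mult G R (\<Xi> \<mu>) (\<Xi> \<rho>) \<in> dual"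
    by (intro \<Xi>_dual dist_mult_dual \<mu> \<rho>)+
  then show "\<Xi> (dist_mult G R \<mu> \<rho>) \<in> dual" "dist_mult G R (\<Xi> \<mu>) (\<Xi> \<rho>) \<in> dual" .
  fix f assume "f \<in> R"
  then show "\<Xi> (dist_mult G R \<mu> \<rho>) f = dist_mult G R (\<Xi> \<mu>) (\<Xi> \<rho>) f"
  proof (induction rule: form_induct)
    case zero
    show ?case
      using dual_zero[OF l] dual_zero[OF r] by (simp only:)
  next
    case (step c b f)
    obtain n :: nat and a d where ad: "\<And>i. i < n \<Longrightarrow> a i \<in> B" "\<And>i. i < n \<Longrightarrow> d i \<in> B"
      and eq: "comult G b = (\<Sum>i<n. pure_tensor (a i) (d i))"
      and eq': "comult G (b ^ q) = (\<Sum>i<n. pure_tensor (a i ^ q) (d i ^ q))"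
      by (rule B_comultE[OF step(1)]) (rule that; simp)
    have "\<Xi> (dist_mult G R \<mu> \<rho>) b = dist_mult G R \<mu> \<rho> (b ^ q)"
      using step(1) by (simp add: \<Xi>_apply B_regular Fr_B)
    also have "\<dots> = (\<Sum>i<n. \<mu> (a i ^ q) * \<rho> (d i ^ q))"
      using ad step(1) by (intro dist_mult_sum[OF \<mu> \<rho> _ _ _ eq']) (simp_all add: B_power_q_regular)
    also have "\<dots> = (\<Sum>i<n. \<Xi> \<mu> (a i) * \<Xi> \<rho> (d i))"
      using ad by (simp add: \<Xi>_apply B_regular Fr_B)
    also have "\<dots> = dist_mult G R (\<Xi> \<mu>) (\<Xi> \<rho>) b"
      using ad step(1)
      by (intro dist_mult_sum[OF \<Xi>_dual[OF \<mu>] \<Xi>_dual[OF \<rho>] _ _ _ eq, symmetric])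
        (simp_all add: B_regular)
    finally show ?case
      using step
      by (simp only: dual_add[OF l] dual_add[OF r] dual_scale[OF l] dual_scale[OF r] B_regular regular_scale)
  qed
qed

text \<open>Each factor \<open>f\<close> uses up one order. Multiplying by
  \<open>unit_function\<close> keeps the case \<open>k = 0\<close> inside \<open>R\<close>, as
  \<open>f ^ 0\<close> is the constant 1 on the whole type.\<close>

lemma shift_power_vanishing:
  assumes "f \<in> aug" "\<mu> \<in> vanishing (n + k)"
  shows "shift (f ^ k * unit_function) \<mu> \<in> vanishing n"
  using assms(2)
proof (induction k arbitrary: \<mu>)
  case 0
  then show ?case
    by (simp add: shift_unit vanishing_dual)
next
  case (Suc k)
  have f: "f \<in> R"
    using augD assms(1) by blast
  have "f ^ k * unit_function \<in> R"
    by (cases k) (auto simp only: power_0 mult_1_left unit_regular mult_unit power_closed[OF f])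
  then have "shift (f ^ Suc k * unit_function) \<mu> = shift (f ^ k * unit_function) (shift f \<mu>)"
    using f by (simp add: mult.assoc shift_mult)
  moreover have "shift f \<mu> \<in> vanishing (n + k)"
    using Suc.prems assms(1) by (simp add: vanishing_Suc)
  moreover have "shift (f ^ k * unit_function) (shift f \<mu>) \<in> vanishing n"
    using calculation(2) by (rule Suc.IH)
  ultimately have "shift (f ^ Suc k * unit_function) \<mu> \<in> vanishing n"
    by (simp only:)
  then show ?case .
qed

text \<open>
  For \<open>b\<close> in the form, \<open>b 1\<close> lies in the prime field, so \<open>Fr b - b 1\<close> is the \<open>q\<close>-th power of an
  element of the augmentation ideal.
\<close>

lemma shift_Fr_vanishing:
  assumes f: "f \<in> R" and \<mu>: "\<mu> \<in> vanishing (n + q)"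
  shows "shift (Fr f - fun_scale (f \<one>) unit_function) \<mu> \<in> vanishing n"
  using f
\<comment> \<open>The elements of \<open>B\<close> met in this induction need not vanish at
  \<open>\<one>\<close>; subtracting the constant makes the claim linear in \<open>f\<close> on all
  of \<open>R\<close>.\<close>
proof (induction rule: form_induct)
  case zero
  have "shift 0 \<mu> = 0"
    using dual_zero[OF vanishing_dual[OF \<mu>]] by (simp add: shift_def fun_eq_iff)
  moreover have "Fr 0 - fun_scale (0 \<one>) unit_function = 0"
    by (simp add: Fr_zero fun_eq_iff)
  ultimately show ?case
    using fun_space.subspace_0[OF vanishing_subspace] by (simp only:)
next
  case (step c b f)
  note dual = vanishing_dual[OF \<mu>]
  define b' where "b' = b - fun_scale (b \<one>) unit_function"
  have b': "b' \<in> aug"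
    unfolding b'_def using step by (intro aug_proj B_regular)
  have "b' ^ q + fun_scale (b \<one>) unit_function = b ^ q"
  proof
    fix x
    have "b' x ^ q + (fun_scale (b \<one>) unit_function x) ^ q = b x ^ q"
      by (simp add: b'_def flip: power_q_add)
    then show "(b' ^ q + fun_scale (b \<one>) unit_function) x = (b ^ q) x"
      using power_q_prime_field[OF B_one[OF step(1)]] q_pos
      by (cases "x \<in> carrier G") (simp_all add: power_fun_apply power_mult_distrib zero_power)
  qed
  then have bq: "b ^ q = b' ^ q + fun_scale (b \<one>) unit_function" ..
  have reg: "b' ^ q \<in> R" "Fr f - fun_scale (f \<one>) unit_function \<in> R"
    using q_eq_Suc power_closed[OF augD(1)[OF b']] step Fr_regular regular_diff regular_scale unit_regular
    by (metis, blast)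
  have "Fr (fun_scale c b + f) = fun_scale c (b ^ q) + Fr f"
    using step by (simp only: Fr_add Fr_scale Fr_B B_regular regular_scale)
  then have eq: "Fr (fun_scale c b + f) - fun_scale ((fun_scale c b + f) \<one>) unit_function
      = fun_scale c (b' ^ q) + (Fr f - fun_scale (f \<one>) unit_function)"
    by (simp add: bq fun_eq_iff algebra_simps)
  have "shift (b' ^ q) \<mu> \<in> vanishing n"
    using shift_power_vanishing[OF b' \<mu>] reg(1) by (simp add: mult_unit)
  moreover have "shift (Fr f - fun_scale (f \<one>) unit_function) \<mu> \<in> vanishing n"
    using step(3) .
  ultimately have "shift (fun_scale c (b' ^ q) + (Fr f - fun_scale (f \<one>) unit_function)) \<mu> \<in> vanishing n"
    using reg
    by (simp add: shift_add_left[OF _ _ dual] shift_scale_left[OF _ dual] regular_scale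
        fun_space.subspace_add[OF vanishing_subspace] fun_space.subspace_scale[OF vanishing_subspace])
  then show ?case
    unfolding eq[symmetric] .
qed

text \<open>Acting by \<open>f\<close> after the Frobenius map is the same as acting by
  \<open>Fr f\<close> before it. For \<open>f\<close> in the augmentation ideal this trades one
  order in the target for \<open>q\<close> orders in the source.\<close>

lemma \<Xi>_vanishing: "\<mu> \<in> vanishing (n * q) \<Longrightarrow> \<Xi> \<mu> \<in> vanishing n"
proof (induction n arbitrary: \<mu>)
  case 0
  then show ?case
    by (simp add: vanishing_0 dist_frob_def fun_eq_iff)
next
  case (Suc n)
  then have \<mu>: "\<mu> \<in> vanishing (n * q + q)"
    by (simp add: add.commute)
  have "shift f (\<Xi> \<mu>) \<in> vanishing n" if f: "f \<in> aug" for f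
  proof -
    have "Fr f - fun_scale (f \<one>) unit_function = Fr f"
      using augD(2)[OF f] by (simp add: fun_eq_iff)
    then have "shift (Fr f) \<mu> \<in> vanishing (n * q)"
      using shift_Fr_vanishing[OF augD(1)[OF f] \<mu>] by metis
    then have "\<Xi> (shift (Fr f) \<mu>) \<in> vanishing n"
      by (rule Suc.IH)
    moreover have "\<Xi> (shift (Fr f) \<mu>) = shift f (\<Xi> \<mu>)"
      using augD(1)[OF f]
      by (simp add: shift_def dist_frob_def fun_eq_iff Fr_regular Fr_mult mult_closed)
    ultimately show ?thesis
      by simp
  qed
  then show ?case
    by (simp add: vanishing_Suc \<Xi>_dual[OF vanishing_dual[OF \<mu>]])
qed

lemma \<Xi>_Dist_plus:
  assumes "\<mu> \<in> Dist_plus G R i"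
  shows "\<Xi> \<mu> \<in> Dist_plus G R (i div q)"
proof -
  \<comment> \<open>The least multiple of \<open>q\<close> above \<open>i\<close>: the functional
    kills the power \<open>Suc i\<close> of the augmentation ideal, hence also the power
    \<open>(i div q + 1) * q\<close>.\<close>
  have "i < Suc (i div q) * q"
    using q_pos dividend_less_div_times by simp
  then have "\<mu> \<in> vanishing (Suc (i div q) * q)"
    using assms vanishing_mono[of "Suc i" "Suc (i div q) * q"] by (auto simp: Dist_plus_iff)
  then have "\<Xi> \<mu> \<in> vanishing (Suc (i div q))"
    by (rule \<Xi>_vanishing)
  with assms show ?thesis
    by (simp add: Dist_plus_iff \<Xi>_apply unit_regular Fr_unit)
qed

lemma dist_morphism_\<Xi>: "dist_morphism G R \<Xi> s"
  by unfold_locales (simp_all add: char_pos q[symmetric] \<Xi>_linear \<Xi>_Dist_plus \<Xi>_dist_mult)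

end

theorem lemma4p1p2:
  fixes G :: "('g, 'm) monoid_scheme"
    and R B :: "('g \<Rightarrow> 'k::alg_closed_field) set"
    and r s :: nat
  assumes "CHAR('k) > 0"
    and "reductive_group G R"
    and "prime_field_form G R B"
    and "s \<le> r"
  shows "equivariant G
           (carrier (U_algebra G R r)) (U_action G R r)
           (carrier (U_algebra G R (r - s))) (frobenius_twist G R B s (U_action G R (r - s)))
           (Upsilon G R B r s)"
proof -
  interpret affine_algebraic_group G R
    using assms(2) by (simp add: reductive_group_def)
  interpret frobenius_form G R B s "CHAR('k) ^ s"
    by unfold_locales (fact assms refl)+
  interpret \<Xi>: dist_morphism G R \<Xi> s
    by (rule dist_morphism_\<Xi>)
  let ?V = "U_space G R r"
  have closed: "Upsilon G R B r s x \<in> carrier (U_algebra G R (r - s))"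
    if "x \<in> carrier (U_algebra G R r)" for x
    unfolding Upsilon_def by (rule \<Xi>.U_map_closed[OF assms(4) that])
  have comm: "Upsilon G R B r s (U_action G R r g x) = U_action G R (r - s) (F g) (Upsilon G R B r s x)"
    if g: "g \<in> carrier G" and x: "x \<in> carrier (U_algebra G R r)" for g x
  proof -
    interpret Ad: dist_morphism G R "Ad G R g" 0
      by (rule dist_morphism_Ad[OF assms(1) g])
    interpret AdF: dist_morphism G R "Ad G R (F g)" 0
      by (rule dist_morphism_Ad[OF assms(1) F_closed[OF g]])
    \<comment> \<open>Both composites are computed on one representative \<open>t\<close> in the
      free algebra, where they become composites of \<open>free_map\<close>. Its letters lie in
      \<open>?V\<close>, hence in \<open>dual\<close>, as \<open>\<Xi>_Ad\<close> requires.\<close>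
    obtain t where t: "t \<in> carrier (free_algebra ?V)"
      and x_eq: "x = U_ideal G R r +>\<^bsub>tensor_algebra ?V\<^esub> (tensor_ideal ?V +>\<^bsub>free_algebra ?V\<^esub> t)"
      by (rule U_algebraE[OF x])
    have At: "free_map (Ad G R g) t \<in> carrier (free_algebra ?V)"
      using free_map_closed[OF t] Ad.image_U_space[of r] by simp
    have \<Xi>t: "free_map \<Xi> t \<in> carrier (free_algebra (U_space G R (r - s)))"
      using free_map_closed[OF t \<Xi>.image_U_space[OF assms(4)]] .
    have "free_map \<Xi> (free_map (Ad G R g) t) = free_map (\<lambda>\<mu>. \<Xi> (Ad G R g \<mu>)) t"
      by (rule free_map_comp[OF t])
    also have "\<dots> = free_map (\<lambda>\<mu>. Ad G R (F g) (\<Xi> \<mu>)) t"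
      by (rule free_map_cong[OF t]) (rule \<Xi>_Ad[OF g U_space_dual])
    also have "\<dots> = free_map (Ad G R (F g)) (free_map \<Xi> t)"
      by (rule free_map_comp[OF t, symmetric])
    finally show ?thesis
      using Ad.U_map_coset[OF _ t] AdF.U_map_coset[OF _ \<Xi>t] \<Xi>.U_map_coset[OF assms(4) t]
        \<Xi>.U_map_coset[OF assms(4) At]
      by (simp add: x_eq Upsilon_def U_action_def)
  qed
  show ?thesis
    using closed comm by (simp add: equivariant_def frobenius_twist_def)
qed

end
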